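(* Let $E$ be a measurable space, $m$ a $\sigma$-finite measure on $E$, and let $(\mathscr{E},\mathscr{F})$ and $(\mathscr{E}',\mathscr{F}')$ be two (not necessarily symmetric) Dirichlet forms on $L^2(E,m)$ such that $\mathscr{E}'\preceq\mathscr{E}$. Let $\tilde{\mathscr{F}}$ be the closure of $\mathscr{F}'$ in $\mathscr{F}$ with respect to the $\mathscr{E}_1$-norm, and set $\tilde{\mathscr{E}}(f,g):=\mathscr{E}(f,g)$ for $f,g\in\tilde{\mathscr{F}}$. Then $\mathscr{E}'$ is strongly subordinate to $\tilde{\mathscr{E}}$, and $\mathscr{E}$ is a Silverstein extension of $\tilde{\mathscr{E}}$. Furthermore, if $(\tilde{\mathscr{E}}^1,\tilde{\mathscr{F}}^1)$ is another Dirichlet form on $L^2(E,m)$ such that $\mathscr{E}'$ is strongly subordinate to $\tilde{\mathscr{E}}^1$ and $\mathscr{E}$ is a Silverstein extension of $\tilde{\mathscr{E}}^1$, then $(\tilde{\mathscr{E}}^1,\tilde{\mathscr{F}}^1)=(\tilde{\mathscr{E}},\tilde{\mathscr{F}})$.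
   Context: A (not necessarily symmetric) Dirichlet form $(\mathscr{E},\mathscr{F})$ on $L^2(E,m)$ is a coercive closed form with the Markovian property: $\mathscr{F}$ is a dense linear subspace of $L^2(E,m)$, $\mathscr{E}$ is bilinear on $\mathscr{F}$, its symmetric part is nonnegative and closed, the sector condition $|\mathscr{E}_1(u,v)|\le K\mathscr{E}_1(u,u)^{1/2}\mathscr{E}_1(v,v)^{1/2}$ holds for some constant $K$ (where $\mathscr{E}_1(u,v)=\mathscr{E}(u,v)+(u,v)_m$), and for $u\in\mathscr{F}$ one has $u^+\wedge1\in\mathscr{F}$ and $\mathscr{E}(u+u^+\wedge1,u-u^+\wedge1)\ge0$, $\mathscr{E}(u-u^+\wedge1,u+u^+\wedge1)\ge0$. The $\mathscr{E}_1$-norm is $\|f\|_{\mathscr{E}_1}=\mathscr{E}_1(f,f)^{1/2}$. Write $\mathrm{b}\mathscr{F}:=\mathscr{F}\cap L^\infty(E,m)$. $\mathrm{b}\mathscr{F}'$ is an algebraic ideal in $\mathrm{b}\mathscr{F}$ if $f\in\mathrm{b}\mathscr{F}'$, $g\in\mathrm{b}\mathscr{F}$ imply $fg\in\mathrm{b}\mathscr{F}'$. Domination: $\mathscr{E}'\preceq\mathscr{E}$ means that the associated $L^2$-semigroups satisfy $T'_tf\le T_tf$ for all $t\ge0$ and all non-negative $f\in L^2(E,m)$; equivalently, $\mathscr{F}'\subset\mathscr{F}$, $\mathrm{b}\mathscr{F}'$ is an algebraic ideal in $\mathrm{b}\mathscr{F}$, and $\mathscr{E}'(f,g)\ge\mathscr{E}(f,g)$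 for all non-negative $f,g\in\mathscr{F}'$. $\mathscr{E}'$ is subordinate to $\mathscr{E}$ if $\mathscr{F}'\subset\mathscr{F}$ and $\mathscr{E}'(f,g)\ge\mathscr{E}(f,g)$ for all non-negative $f,g\in\mathscr{F}'$; it is strongly subordinate to $\mathscr{E}$ if, in addition, $\mathscr{F}'$ is dense in $\mathscr{F}$ with respect to the $\mathscr{E}_1$-norm. $\mathscr{E}$ is a Silverstein extension of $\mathscr{E}'$ if $\mathrm{b}\mathscr{F}'$ is an algebraic ideal in $\mathrm{b}\mathscr{F}$ and $\mathscr{E}=\mathscr{E}'$ on $\mathrm{b}\mathscr{F}'\times\mathrm{b}\mathscr{F}'$. *)

theory Defs
  imports "HOL-Analysis.Analysis"
begin

text \<open>
  Elements of \<open>L\<^sup>2(E,m)\<close> are represented by real-valued measurable functions rather than by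
  classes modulo \<open>m\<close>-null sets. A form domain is therefore required to be saturated under
  equality almost everywhere, and forms and operators are required to respect it; equality of
  saturated sets of functions is then the same as equality of the sets of classes.
\<close>

definition L2 :: "'a measure \<Rightarrow> ('a \<Rightarrow> real) set" where
  "L2 m = {f \<in> borel_measurable m. integrable m (\<lambda>x. (f x)\<^sup>2)}"

definition l2_inner :: "'a measure \<Rightarrow> ('a \<Rightarrow> real) \<Rightarrow> ('a \<Rightarrow> real) \<Rightarrow> real" where
  "l2_inner m f g = (\<integral>x. f x * g x \<partial>m)"

definition l2_norm :: "'a measure \<Rightarrow> ('a \<Rightarrow> real) \<Rightarrow> real" where
  "l2_norm m f = sqrt (l2_inner m f f)"

type_synonym 'a form = "('a \<Rightarrow> real) \<Rightarrow> ('a \<Rightarrow> real) \<Rightarrow> real"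

definition form_shift :: "'a measure \<Rightarrow> 'a form \<Rightarrow> real \<Rightarrow> 'a form" where
  "form_shift m \<E> \<alpha> u v = \<E> u v + \<alpha> * l2_inner m u v"

definition E1_norm :: "'a measure \<Rightarrow> 'a form \<Rightarrow> ('a \<Rightarrow> real) \<Rightarrow> real" where
  "E1_norm m \<E> u = sqrt (form_shift m \<E> 1 u u)"

definition unit_contraction :: "('a \<Rightarrow> real) \<Rightarrow> 'a \<Rightarrow> real" where
  "unit_contraction u = (\<lambda>x. min (max (u x) 0) 1)"

text \<open>
  A form is a pair of a function \<open>\<E>\<close> and a domain \<open>\<F>\<close>; the values of \<open>\<E>\<close> outside
  \<open>\<F> \<times> \<F>\<close> are irrelevant. Closedness of the symmetric part is completeness of \<open>\<F>\<close> in the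
  \<open>\<E>\<^sub>1\<close>-norm, which depends only on the diagonal of \<open>\<E>\<close> and hence only on the symmetric part.
\<close>

locale dirichlet_form =
  fixes m :: "'a measure" and \<E> :: "'a form" and \<F> :: "('a \<Rightarrow> real) set"
  assumes dom_L2: "\<F> \<subseteq> L2 m"
    and dom_AE: "\<lbrakk>f \<in> \<F>; g \<in> borel_measurable m; AE x in m. f x = g x\<rbrakk> \<Longrightarrow> g \<in> \<F>"
    and dom_zero: "(\<lambda>x. 0) \<in> \<F>"
    and dom_add: "\<lbrakk>f \<in> \<F>; g \<in> \<F>\<rbrakk> \<Longrightarrow> (\<lambda>x. f x + g x) \<in> \<F>"
    and dom_scale: "f \<in> \<F> \<Longrightarrow> (\<lambda>x. c * f x) \<in> \<F>"
    and dom_dense: "\<lbrakk>f \<in> L2 m; 0 < \<epsilon>\<rbrakk> \<Longrightarrow> \<exists>g\<in>\<F>. l2_norm m (\<lambda>x. f x - g x) < \<epsilon>"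
    and form_AE: "\<lbrakk>f \<in> \<F>; f' \<in> \<F>; g \<in> \<F>; g' \<in> \<F>;
        AE x in m. f x = f' x; AE x in m. g x = g' x\<rbrakk> \<Longrightarrow> \<E> f g = \<E> f' g'"
    and form_add_left: "\<lbrakk>f \<in> \<F>; g \<in> \<F>; h \<in> \<F>\<rbrakk> \<Longrightarrow> \<E> (\<lambda>x. f x + g x) h = \<E> f h + \<E> g h"
    and form_add_right: "\<lbrakk>f \<in> \<F>; g \<in> \<F>; h \<in> \<F>\<rbrakk> \<Longrightarrow> \<E> h (\<lambda>x. f x + g x) = \<E> h f + \<E> h g"
    and form_scale_left: "\<lbrakk>f \<in> \<F>; g \<in> \<F>\<rbrakk> \<Longrightarrow> \<E> (\<lambda>x. c * f x) g = c * \<E> f g"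
    and form_scale_right: "\<lbrakk>f \<in> \<F>; g \<in> \<F>\<rbrakk> \<Longrightarrow> \<E> f (\<lambda>x. c * g x) = c * \<E> f g"
    and form_nonneg: "f \<in> \<F> \<Longrightarrow> 0 \<le> \<E> f f"
    and form_closed: "\<lbrakk>\<And>n. w n \<in> \<F>;
        \<forall>\<epsilon>>0. \<exists>N. \<forall>i\<ge>N. \<forall>j\<ge>N. E1_norm m \<E> (\<lambda>x. w i x - w j x) < \<epsilon>\<rbrakk>
      \<Longrightarrow> \<exists>f\<in>\<F>. (\<lambda>n::nat. E1_norm m \<E> (\<lambda>x. w n x - f x)) \<longlonglongrightarrow> 0"
    and sector: "\<exists>K. \<forall>u\<in>\<F>. \<forall>v\<in>\<F>.
        \<bar>form_shift m \<E> 1 u v\<bar> \<le> K * E1_norm m \<E> u * E1_norm m \<E> v"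
    and markov_dom: "u \<in> \<F> \<Longrightarrow> unit_contraction u \<in> \<F>"
    and markov1: "u \<in> \<F> \<Longrightarrow>
        0 \<le> \<E> (\<lambda>x. u x + unit_contraction u x) (\<lambda>x. u x - unit_contraction u x)"
    and markov2: "u \<in> \<F> \<Longrightarrow>
        0 \<le> \<E> (\<lambda>x. u x - unit_contraction u x) (\<lambda>x. u x + unit_contraction u x)"

text \<open>Strongly continuous contraction semigroups on \<open>L\<^sup>2(E,m)\<close>.\<close>

locale l2_semigroup =
  fixes m :: "'a measure" and T :: "real \<Rightarrow> ('a \<Rightarrow> real) \<Rightarrow> 'a \<Rightarrow> real"
  assumes maps_L2: "\<lbrakk>0 \<le> t; f \<in> L2 m\<rbrakk> \<Longrightarrow> T t f \<in> L2 m"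
    and cong_AE: "\<lbrakk>0 \<le> t; f \<in> L2 m; g \<in> L2 m; AE x in m. f x = g x\<rbrakk>
      \<Longrightarrow> AE x in m. T t f x = T t g x"
    and add_AE: "\<lbrakk>0 \<le> t; f \<in> L2 m; g \<in> L2 m\<rbrakk>
      \<Longrightarrow> AE x in m. T t (\<lambda>y. f y + g y) x = T t f x + T t g x"
    and scale_AE: "\<lbrakk>0 \<le> t; f \<in> L2 m\<rbrakk> \<Longrightarrow> AE x in m. T t (\<lambda>y. c * f y) x = c * T t f x"
    and contraction: "\<lbrakk>0 \<le> t; f \<in> L2 m\<rbrakk> \<Longrightarrow> l2_norm m (T t f) \<le> l2_norm m f"
    and at_zero: "f \<in> L2 m \<Longrightarrow> AE x in m. T 0 f x = f x"
    and semigroup: "\<lbrakk>0 \<le> s; 0 \<le> t; f \<in> L2 m\<rbrakk> \<Longrightarrow> AE x in m. T (s + t) f x = T s (T t f) x"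
    and strongly_continuous: "f \<in> L2 m
      \<Longrightarrow> ((\<lambda>t. l2_norm m (\<lambda>x. T t f x - f x)) \<longlongrightarrow> 0) (at_right 0)"

text \<open>
  The semigroup of a form is the one whose resolvent \<open>G\<^sub>\<alpha> = \<integral>\<^sub>0\<^sup>\<infinity> e\<^bsup>-\<alpha>t\<^esup> T\<^sub>t dt\<close> (a weak integral in
  \<open>L\<^sup>2\<close>) is the resolvent of the form: \<open>G\<^sub>\<alpha> f \<in> \<F>\<close> and \<open>\<E>\<^sub>\<alpha>(G\<^sub>\<alpha> f, v) = (f, v)\<^sub>m\<close> for all \<open>v \<in> \<F>\<close>.
  Below, \<open>u\<close> is \<open>G\<^sub>\<alpha> f\<close>.
\<close>

definition associated_semigroup ::
    "'a measure \<Rightarrow> 'a form \<Rightarrow> ('a \<Rightarrow> real) set \<Rightarrow> (real \<Rightarrow> ('a \<Rightarrow> real) \<Rightarrow> 'a \<Rightarrow> real) \<Rightarrow> bool" where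
  "associated_semigroup m \<E> \<F> T \<longleftrightarrow> l2_semigroup m T \<and>
     (\<forall>\<alpha>>0. \<forall>f\<in>L2 m. \<exists>u\<in>\<F>.
        (\<forall>v\<in>\<F>. form_shift m \<E> \<alpha> u v = l2_inner m f v) \<and>
        (\<forall>g\<in>L2 m. ((\<lambda>t. exp (- \<alpha> * t) * l2_inner m (T t f) g) has_integral l2_inner m u g) {0..}))"

text \<open>
  \<open>\<E>' \<preceq> \<E>\<close>. A Dirichlet form has exactly one associated semigroup up to equality almost
  everywhere, so the existential quantifiers only name the two semigroups.
\<close>

definition dominated_by ::
    "'a measure \<Rightarrow> 'a form \<Rightarrow> ('a \<Rightarrow> real) set \<Rightarrow> 'a form \<Rightarrow> ('a \<Rightarrow> real) set \<Rightarrow> bool" where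
  "dominated_by m \<E>' \<F>' \<E> \<F> \<longleftrightarrow>
     (\<exists>T' T. associated_semigroup m \<E>' \<F>' T' \<and> associated_semigroup m \<E> \<F> T \<and>
        (\<forall>t\<ge>0. \<forall>f\<in>L2 m. (AE x in m. 0 \<le> f x) \<longrightarrow> (AE x in m. T' t f x \<le> T t f x)))"

definition bounded_part :: "'a measure \<Rightarrow> ('a \<Rightarrow> real) set \<Rightarrow> ('a \<Rightarrow> real) set" where
  "bounded_part m \<F> = {f \<in> \<F>. \<exists>C. AE x in m. \<bar>f x\<bar> \<le> C}"

definition algebraic_ideal :: "('a \<Rightarrow> real) set \<Rightarrow> ('a \<Rightarrow> real) set \<Rightarrow> bool" where
  "algebraic_ideal I A \<longleftrightarrow> I \<subseteq> A \<and> (\<forall>f\<in>I. \<forall>g\<in>A. (\<lambda>x. f x * g x) \<in> I)"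

definition E1_closure ::
    "'a measure \<Rightarrow> 'a form \<Rightarrow> ('a \<Rightarrow> real) set \<Rightarrow> ('a \<Rightarrow> real) set \<Rightarrow> ('a \<Rightarrow> real) set" where
  "E1_closure m \<E> \<F> S = {f \<in> \<F>. \<forall>\<epsilon>>0. \<exists>g\<in>S. E1_norm m \<E> (\<lambda>x. f x - g x) < \<epsilon>}"

definition subordinate ::
    "'a measure \<Rightarrow> 'a form \<Rightarrow> ('a \<Rightarrow> real) set \<Rightarrow> 'a form \<Rightarrow> ('a \<Rightarrow> real) set \<Rightarrow> bool" where
  "subordinate m \<E>' \<F>' \<E> \<F> \<longleftrightarrow> \<F>' \<subseteq> \<F> \<and>
     (\<forall>f\<in>\<F>'. \<forall>g\<in>\<F>'. (AE x in m. 0 \<le> f x) \<longrightarrow> (AE x in m. 0 \<le> g x) \<longrightarrow> \<E>' f g \<ge> \<E> f g)"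

definition strongly_subordinate ::
    "'a measure \<Rightarrow> 'a form \<Rightarrow> ('a \<Rightarrow> real) set \<Rightarrow> 'a form \<Rightarrow> ('a \<Rightarrow> real) set \<Rightarrow> bool" where
  "strongly_subordinate m \<E>' \<F>' \<E> \<F> \<longleftrightarrow>
     subordinate m \<E>' \<F>' \<E> \<F> \<and> E1_closure m \<E> \<F> \<F>' = \<F>"

text \<open>\<open>(\<E>, \<F>)\<close> is a Silverstein extension of \<open>(\<E>', \<F>')\<close>.\<close>

definition silverstein_extension ::
    "'a measure \<Rightarrow> 'a form \<Rightarrow> ('a \<Rightarrow> real) set \<Rightarrow> 'a form \<Rightarrow> ('a \<Rightarrow> real) set \<Rightarrow> bool" where
  "silverstein_extension m \<E> \<F> \<E>' \<F>' \<longleftrightarrow>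
     algebraic_ideal (bounded_part m \<F>') (bounded_part m \<F>) \<and>
     (\<forall>f\<in>bounded_part m \<F>'. \<forall>g\<in>bounded_part m \<F>'. \<E> f g = \<E>' f g)"

end

theory Submission
  imports Defs
begin

text \<open>
  Write \<open>G\<^sub>\<alpha>\<close>, \<open>G'\<^sub>\<alpha>\<close> for the resolvents of \<open>\<E>\<close>, \<open>\<E>'\<close> and \<open>\<E>\<^bsup>(\<alpha>)\<^esup>(f, g) = \<alpha> (f - \<alpha> G\<^sub>\<alpha> f, g)\<close> for the
  approximating forms. A function of \<open>L\<^sup>2\<close> is in the form domain if and only if
  \<open>\<E>\<^bsup>(\<alpha>)\<^esup>(f, f)\<close> is bounded in \<open>\<alpha>\<close>, and then \<open>\<E>\<^bsup>(\<alpha>)\<^esup>(f, g)\<close> tends to \<open>\<E>(f, g)\<close>. Domination of the semigroups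
  passes to their Laplace transforms, that is, \<open>G'\<^sub>\<alpha> f \<le> G\<^sub>\<alpha> f\<close> for \<open>f \<ge> 0\<close>, hence
  \<open>\<E>\<^bsup>(\<alpha>)\<^esup> \<le> \<E>'\<^bsup>(\<alpha>)\<^esup>\<close> on nonnegative functions. Letting \<open>\<alpha>\<close> tend to infinity gives \<open>\<F>' \<subseteq> \<F>\<close> and
  \<open>\<E>' \<ge> \<E>\<close> on nonnegative functions.

  The same forms show that \<open>\<F>'\<close> is an order ideal of \<open>\<F>\<close>: as \<open>G\<^sub>\<alpha> - G'\<^sub>\<alpha>\<close> preserves positivity,
  \<open>0 \<le> v \<le> u\<close> implies \<open>\<E>'\<^bsup>(\<alpha>)\<^esup>(v, v) - \<E>\<^bsup>(\<alpha>)\<^esup>(v, v) \<le> \<E>'\<^bsup>(\<alpha>)\<^esup>(u, u) - \<E>\<^bsup>(\<alpha>)\<^esup>(u, u)\<close>, and the right-hand side stays bounded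
  for \<open>u \<in> \<F>'\<close>. The order ideal property survives the closure in the \<open>\<E>\<^sub>1\<close>-norm. Since the
  bounded functions of \<open>\<F>\<close> form an algebra and \<open>f g \<le> C f\<close> if \<open>0 \<le> f\<close> and \<open>0 \<le> g \<le> C\<close>, an order
  ideal is an algebraic ideal, which is the nontrivial part of the Silverstein property.

  All limits that stay in a form domain come from one Fatou lemma (\<open>bounded_energy_L2_limit\<close>): a limit
  in \<open>L\<^sup>2\<close> of functions of bounded energy is in the domain. It holds in every closed subspace as well,
  in particular in the closure of \<open>\<F>'\<close>, which inherits the Markovian property and the ideal
  property in this way. It is proved by minimising the norm over convex sets.

  Uniqueness holds because the bounded functions are dense in the domain of every Dirichlet
  form: a form that \<open>\<E>\<close> extends in the sense of Silverstein agrees with \<open>\<E>\<close> on its bounded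
  functions, hence on its whole domain, and this domain is then the closure of \<open>\<F>'\<close> in either norm.
\<close>

section \<open>Nonnegative bilinear forms on spaces of functions\<close>

text \<open>Only pointwise linear structure is assumed, so that the inner product of \<open>L\<^sup>2\<close>, a form \<open>\<E>\<close> and
  its shift \<open>\<E>\<^sub>1\<close> are all instances. The norm of a form that is not symmetric is that of its symmetric part.\<close>

locale psd_form =
  fixes V :: "('a \<Rightarrow> real) set" and B :: "'a form"
  assumes zero: "(\<lambda>x. 0) \<in> V"
    and add: "\<lbrakk>u \<in> V; v \<in> V\<rbrakk> \<Longrightarrow> (\<lambda>x. u x + v x) \<in> V"
    and scale: "u \<in> V \<Longrightarrow> (\<lambda>x. c * u x) \<in> V"
    and add_left: "\<lbrakk>u \<in> V; v \<in> V; w \<in> V\<rbrakk> \<Longrightarrow> B (\<lambda>x. u x + v x) w = B u w + B v w"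
    and add_right: "\<lbrakk>u \<in> V; v \<in> V; w \<in> V\<rbrakk> \<Longrightarrow> B w (\<lambda>x. u x + v x) = B w u + B w v"
    and scale_left: "\<lbrakk>u \<in> V; v \<in> V\<rbrakk> \<Longrightarrow> B (\<lambda>x. c * u x) v = c * B u v"
    and scale_right: "\<lbrakk>u \<in> V; v \<in> V\<rbrakk> \<Longrightarrow> B u (\<lambda>x. c * v x) = c * B u v"
    and nonneg: "u \<in> V \<Longrightarrow> 0 \<le> B u u"
begin

abbreviation nrm :: "('a \<Rightarrow> real) \<Rightarrow> real" where "nrm u \<equiv> sqrt (B u u)"

lemma diff: assumes "u \<in> V" "v \<in> V" shows "(\<lambda>x. u x - v x) \<in> V"
  using add[OF assms(1) scale[OF assms(2), of "-1"]] by simp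

lemma diff_left:
  assumes "u \<in> V" "v \<in> V" "w \<in> V" shows "B (\<lambda>x. u x - v x) w = B u w - B v w"
  using add_left[OF assms(1) scale[OF assms(2), of "-1"] assms(3)]
    scale_left[OF assms(2,3), of "-1"] by simp

lemma diff_right:
  assumes "u \<in> V" "v \<in> V" "w \<in> V" shows "B w (\<lambda>x. u x - v x) = B w u - B w v"
  using add_right[OF assms(1) scale[OF assms(2), of "-1"] assms(3)]
    scale_right[OF assms(3,2), of "-1"] by simp

lemmas bilinear = add scale diff add_left add_right scale_left scale_right diff_left diff_right

lemma nrm_nonneg: "u \<in> V \<Longrightarrow> 0 \<le> nrm u"
  using nonneg by simp

lemma nrm_sq: "u \<in> V \<Longrightarrow> (nrm u)\<^sup>2 = B u u"
  using nonneg by simp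

lemma parallelogram:
  assumes "u \<in> V" "v \<in> V"
  shows "B (\<lambda>x. u x - v x) (\<lambda>x. u x - v x)
    = 2 * B u u + 2 * B v v - 4 * B (\<lambda>x. (u x + v x) / 2) (\<lambda>x. (u x + v x) / 2)"
proof -
  have "B (\<lambda>x. c * (u x + v x)) (\<lambda>x. c * (u x + v x))
      = c * (c * (B u u + B u v + B v u + B v v))" for c
    using assms by (simp add: bilinear) (simp add: algebra_simps)
  from this[of "1/2"] have "B (\<lambda>x. (u x + v x) / 2) (\<lambda>x. (u x + v x) / 2)
      = (B u u + B u v + B v u + B v v) / 4"
    by simp
  then show ?thesis using assms by (simp add: bilinear algebra_simps)
qed

lemma midpoint: "\<lbrakk>u \<in> V; v \<in> V\<rbrakk> \<Longrightarrow> (\<lambda>x. (u x + v x) / 2) \<in> V"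
  using scale[OF add, of u v "1/2"] by simp

lemma midpoint_le:
  assumes "u \<in> V" "v \<in> V" "B u u \<le> M" "B v v \<le> M"
  shows "B (\<lambda>x. (u x + v x) / 2) (\<lambda>x. (u x + v x) / 2) \<le> M"
  using parallelogram[OF assms(1,2)] nonneg[OF diff[OF assms(1,2)]] assms(3,4) by linarith

text \<open>The Cauchy-Schwarz inequality for the symmetric part. Scaling both arguments to norm at most
  one makes the sign of a single square decide; the \<open>\<epsilon>\<close> avoids a case distinction on
  vectors of norm zero.\<close>

lemma cauchy_schwarz:
  assumes u: "u \<in> V" and v: "v \<in> V"
  shows "B u v + B v u \<le> 2 * nrm u * nrm v"
proof -
  have *: "B u v + B v u \<le> 2 * (nrm u + \<epsilon>) * (nrm v + \<epsilon>)" if "\<epsilon> > 0" for \<epsilon>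
  proof -
    define a b where "a = nrm u + \<epsilon>" and "b = nrm v + \<epsilon>"
    have pos: "a > 0" "b > 0"
      unfolding a_def b_def using nrm_nonneg[OF u] nrm_nonneg[OF v] that by linarith+
    have "(nrm u)\<^sup>2 \<le> a\<^sup>2" "(nrm v)\<^sup>2 \<le> b\<^sup>2"
      unfolding a_def b_def using nrm_nonneg[OF u] nrm_nonneg[OF v] that
      by (intro power_mono; linarith)+
    then have "B u u \<le> a\<^sup>2" "B v v \<le> b\<^sup>2"
      by (simp_all only: nrm_sq[OF u] nrm_sq[OF v])
    then have "b\<^sup>2 * B u u \<le> b\<^sup>2 * a\<^sup>2" "a\<^sup>2 * B v v \<le> a\<^sup>2 * b\<^sup>2"
      by (auto intro!: mult_left_mono)
    moreover have "0 \<le> B (\<lambda>x. b * u x - a * v x) (\<lambda>x. b * u x - a * v x)"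
      using u v by (intro nonneg diff scale)
    then have "0 \<le> b\<^sup>2 * B u u - a * b * (B u v + B v u) + a\<^sup>2 * B v v"
      using u v by (simp add: bilinear algebra_simps power2_eq_square)
    ultimately have "a * b * (B u v + B v u) \<le> a * b * (2 * a * b)"
      by (simp add: algebra_simps power2_eq_square)
    then have "B u v + B v u \<le> 2 * a * b"
      using pos by (simp add: mult_le_cancel_left)
    then show ?thesis by (simp add: a_def b_def)
  qed
  have "((\<lambda>\<epsilon>. 2 * (nrm u + \<epsilon>) * (nrm v + \<epsilon>)) \<longlongrightarrow> 2 * (nrm u + 0) * (nrm v + 0)) (at_right 0)"
    by (intro tendsto_intros)
  moreover have "\<forall>\<^sub>F \<epsilon> in at_right 0. B u v + B v u \<le> 2 * (nrm u + \<epsilon>) * (nrm v + \<epsilon>)"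
    using * by (auto simp: eventually_at_filter)
  ultimately show ?thesis
    using tendsto_lowerbound[OF _ _ trivial_limit_at_right_real] by fastforce
qed

lemma triangle:
  assumes "u \<in> V" "v \<in> V"
  shows "nrm (\<lambda>x. u x + v x) \<le> nrm u + nrm v"
proof (rule real_le_lsqrt)
  show "B (\<lambda>x. u x + v x) (\<lambda>x. u x + v x) \<le> (nrm u + nrm v)\<^sup>2"
    using assms cauchy_schwarz[OF assms] nrm_sq[OF assms(1)] nrm_sq[OF assms(2)]
    by (simp add: bilinear power2_sum)
qed (use assms nrm_nonneg in auto)

lemma nrm_scale: "u \<in> V \<Longrightarrow> nrm (\<lambda>x. c * u x) = \<bar>c\<bar> * nrm u"
  by (simp add: bilinear real_sqrt_mult flip: mult.assoc)

lemma diff_swap: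
  assumes "u \<in> V" "v \<in> V"
  shows "B (\<lambda>x. u x - v x) (\<lambda>x. u x - v x) = B (\<lambda>x. v x - u x) (\<lambda>x. v x - u x)"
  using assms by (simp add: bilinear)

lemma triangle_diff:
  assumes "u \<in> V" "v \<in> V"
  shows "nrm (\<lambda>x. u x - v x) \<le> nrm u + nrm v"
  using triangle[OF assms(1) scale[OF assms(2), of "-1"]] nrm_scale[OF assms(2), of "-1"] by simp

lemma triangle_via:
  assumes "u \<in> V" "v \<in> V" "w \<in> V"
  shows "nrm (\<lambda>x. u x - w x) \<le> nrm (\<lambda>x. u x - v x) + nrm (\<lambda>x. v x - w x)"
  using triangle[OF diff[OF assms(1,2)] diff[OF assms(2,3)]] by simp

lemma nrm_le_approx:
  assumes "u \<in> V" "v \<in> V"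
  shows "nrm v \<le> nrm u + nrm (\<lambda>x. u x - v x)"
  using triangle_diff[OF assms(1) diff[OF assms]] by simp

lemma nrm_sum:
  assumes "\<And>i::nat. i < n \<Longrightarrow> u i \<in> V"
  shows "(\<lambda>x. \<Sum>i<n. u i x) \<in> V \<and> nrm (\<lambda>x. \<Sum>i<n. u i x) \<le> (\<Sum>i<n. nrm (u i))"
  using assms
proof (induction n)
  case 0
  have "B (\<lambda>x. 0 * (0::real)) (\<lambda>x. 0) = 0" using scale_left[OF zero zero, of 0] by simp
  then show ?case using zero by simp
next
  case (Suc n)
  then have IH: "(\<lambda>x. \<Sum>i<n. u i x) \<in> V" "nrm (\<lambda>x. \<Sum>i<n. u i x) \<le> (\<Sum>i<n. nrm (u i))"
    and "u n \<in> V" by auto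
  then show ?case using add[of _ "u n"] triangle[of _ "u n"] by fastforce
qed

lemma nrm_tendsto:
  assumes w: "\<And>n::nat. w n \<in> V" and f: "f \<in> V"
    and lim: "(\<lambda>n. nrm (\<lambda>x. w n x - f x)) \<longlonglongrightarrow> 0"
  shows "(\<lambda>n. nrm (w n)) \<longlonglongrightarrow> nrm f"
proof -
  have "norm (nrm (w n) - nrm f) \<le> nrm (\<lambda>x. w n x - f x)" for n
    using nrm_le_approx[OF w[of n] f] nrm_le_approx[OF f w[of n]] diff_swap[OF f w[of n]] by auto
  then have "(\<lambda>n. nrm (w n) - nrm f) \<longlonglongrightarrow> 0"
    by (rule Lim_null_comparison[OF always_eventually[OF allI] lim])
  then show ?thesis by (rule LIM_zero_cancel)
qed

lemma Cauchy_of_tendsto: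
  assumes w: "\<And>n::nat. w n \<in> V" and f: "f \<in> V"
    and lim: "(\<lambda>n. nrm (\<lambda>x. w n x - f x)) \<longlonglongrightarrow> 0"
  shows "\<forall>\<epsilon>>0. \<exists>N. \<forall>i\<ge>N. \<forall>j\<ge>N. nrm (\<lambda>x. w i x - w j x) < \<epsilon>"
proof (intro allI impI)
  fix \<epsilon> :: real assume "\<epsilon> > 0"
  then have "\<forall>\<^sub>F n in sequentially. nrm (\<lambda>x. w n x - f x) < \<epsilon> / 2"
    using order_tendstoD(2)[OF lim, of "\<epsilon>/2"] by simp
  then obtain N where N: "\<And>n. n \<ge> N \<Longrightarrow> nrm (\<lambda>x. w n x - f x) < \<epsilon> / 2"
    by (auto simp: eventually_sequentially)
  have "nrm (\<lambda>x. w i x - w j x) < \<epsilon>" if "i \<ge> N" "j \<ge> N" for i j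
    using triangle_via[OF w[of i] f w[of j]] N[OF that(1)] N[OF that(2)] diff_swap[OF f w[of j]] by simp
  then show "\<exists>N. \<forall>i\<ge>N. \<forall>j\<ge>N. nrm (\<lambda>x. w i x - w j x) < \<epsilon>" by blast
qed

lemma tendsto_of_bounded:
  assumes bd: "\<And>u v. \<lbrakk>u \<in> V; v \<in> V\<rbrakk> \<Longrightarrow> \<bar>B u v\<bar> \<le> K * nrm u * nrm v"
    and a: "\<And>n::nat. a n \<in> V" and b: "\<And>n. b n \<in> V" and f: "f \<in> V" and g: "g \<in> V"
    and lima: "(\<lambda>n. nrm (\<lambda>x. a n x - f x)) \<longlonglongrightarrow> 0"
    and limb: "(\<lambda>n. nrm (\<lambda>x. b n x - g x)) \<longlonglongrightarrow> 0"
  shows "(\<lambda>n. B (a n) (b n)) \<longlonglongrightarrow> B f g"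
proof -
  let ?r = "\<lambda>n. K * nrm (\<lambda>x. a n x - f x) * nrm (b n) + K * nrm f * nrm (\<lambda>x. b n x - g x)"
  have "B (a n) (b n) - B f g = B (\<lambda>x. a n x - f x) (b n) + B f (\<lambda>x. b n x - g x)" for n
    using a b f g by (simp add: bilinear)
  then have "norm (B (a n) (b n) - B f g) \<le> ?r n" for n
    using bd[OF diff[OF a[of n] f] b[of n]] bd[OF f diff[OF b[of n] g]] by simp
  moreover have "?r \<longlonglongrightarrow> K * 0 * nrm g + K * nrm f * 0"
    by (intro tendsto_add tendsto_mult tendsto_const lima limb nrm_tendsto[OF b g limb])
  then have lim: "?r \<longlonglongrightarrow> 0" by simp
  ultimately have "(\<lambda>n. B (a n) (b n) - B f g) \<longlonglongrightarrow> 0"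
    by (intro Lim_null_comparison[OF always_eventually[OF allI] lim])
  then show ?thesis by (rule LIM_zero_cancel)
qed

text \<open>Elements of almost minimal energy in a decreasing sequence of convex sets form a Cauchy
  sequence: the minimal energies increase to a finite limit, and by the parallelogram identity two
  almost minimal elements whose midpoint has no smaller energy are close. In a complete space
  this gives convergence to a point of all closures, so it does the work of weak compactness.\<close>

lemma Cauchy_minimisers:
  assumes sub: "\<And>n::nat. S n \<subseteq> V"
    and dec: "\<And>n k. n \<le> k \<Longrightarrow> S k \<subseteq> S n"
    and mid: "\<And>n u v. \<lbrakk>u \<in> S n; v \<in> S n\<rbrakk> \<Longrightarrow> (\<lambda>x. (u x + v x) / 2) \<in> S n"
    and ex: "\<And>n. \<exists>u\<in>S n. B u u \<le> M"
  shows "\<exists>w. (\<forall>n. w n \<in> S n) \<and>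
    (\<forall>\<epsilon>>0. \<exists>N. \<forall>i\<ge>N. \<forall>j\<ge>N. nrm (\<lambda>x. w i x - w j x) < \<epsilon>)"
proof -
  define d where "d n = (INF u\<in>S n. B u u)" for n
  have bdd: "bdd_below ((\<lambda>u. B u u) ` S n)" for n
    using sub[of n] nonneg by (intro bdd_belowI2[of _ 0]) auto
  have ne: "S n \<noteq> {}" for n using ex[of n] by auto
  have d_le: "d n \<le> B u u" if "u \<in> S n" for n u
    unfolding d_def using bdd that by (rule cINF_lower)
  have d_mono: "incseq d"
  proof (rule incseq_SucI)
    fix n
    show "d n \<le> d (Suc n)"
      unfolding d_def by (rule cINF_superset_mono[OF ne bdd dec]) auto
  qed
  have "d n \<le> M" for n using ex[of n] d_le by force
  then obtain L where L: "d \<longlonglongrightarrow> L" "\<And>n. d n \<le> L"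
    using incseq_convergent[OF d_mono, of M] by auto
  define e :: "nat \<Rightarrow> real" where "e n = inverse (real (Suc n))" for n
  have "e \<longlonglongrightarrow> 0"
    unfolding e_def by (rule LIMSEQ_inverse_real_of_nat)
  then have e: "e n > 0" "e \<longlonglongrightarrow> 0" "n \<le> k \<Longrightarrow> e k \<le> e n" for n k
    by (auto simp: e_def intro!: le_imp_inverse_le)
  have "\<exists>u\<in>S n. B u u < d n + e n" for n
    using cINF_less_iff[OF ne bdd, of n "d n + e n"] e(1)[of n] by (simp add: d_def)
  then obtain w where w: "\<And>n. w n \<in> S n" "\<And>n. B (w n) (w n) < d n + e n"
    by metis
  have wV: "w n \<in> V" for n using w(1) sub by blast
  have close: "B (\<lambda>x. w i x - w j x) (\<lambda>x. w i x - w j x)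
      \<le> 4 * (L - d n) + 4 * e n" if "n \<le> i" "n \<le> j" for i j n
  proof -
    have "w i \<in> S n" "w j \<in> S n" using w(1) dec that by blast+
    from d_le[OF mid[OF this]] have "d n \<le> B (\<lambda>x. (w i x + w j x) / 2) (\<lambda>x. (w i x + w j x) / 2)" .
    moreover have "B (w i) (w i) \<le> L + e n" "B (w j) (w j) \<le> L + e n"
      using w(2)[of i] w(2)[of j] L(2)[of i] L(2)[of j] e(3)[OF that(1)] e(3)[OF that(2)]
      by linarith+
    ultimately show ?thesis
      unfolding parallelogram[OF wV wV, of i j] by (simp add: algebra_simps)
  qed
  have lim: "(\<lambda>n. 4 * (L - d n) + 4 * e n) \<longlonglongrightarrow> 4 * (L - L) + 4 * 0"
    by (intro tendsto_intros L e(2))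
  have "\<exists>N. \<forall>i\<ge>N. \<forall>j\<ge>N. nrm (\<lambda>x. w i x - w j x) < \<epsilon>" if "\<epsilon> > 0" for \<epsilon>
  proof -
    have "\<forall>\<^sub>F n in sequentially. 4 * (L - d n) + 4 * e n < \<epsilon>\<^sup>2"
      using order_tendstoD(2)[OF lim, of "\<epsilon>\<^sup>2"] that by simp
    then obtain N where "4 * (L - d N) + 4 * e N < \<epsilon>\<^sup>2"
      by (auto simp: eventually_sequentially)
    then have "nrm (\<lambda>x. w i x - w j x) < \<epsilon>" if "N \<le> i" "N \<le> j" for i j
      using close[OF that] \<open>\<epsilon> > 0\<close> by (intro real_less_lsqrt) auto
    then show ?thesis by blast
  qed
  then show ?thesis using w(1) by blast
qed

end

section \<open>Square-integrable functions\<close>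

lemma L2_measurable: "f \<in> L2 m \<Longrightarrow> f \<in> borel_measurable m"
  by (simp add: L2_def)

lemma L2_integrable_mult:
  assumes "f \<in> L2 m" "g \<in> L2 m"
  shows "integrable m (\<lambda>x. f x * g x)"
proof (rule Bochner_Integration.integrable_bound)
  show "integrable m (\<lambda>x. (f x)\<^sup>2 + (g x)\<^sup>2)" using assms by (auto simp: L2_def)
  show "(\<lambda>x. f x * g x) \<in> borel_measurable m" using assms by (auto simp: L2_def)
  have "\<bar>a * b\<bar> \<le> a\<^sup>2 + b\<^sup>2" for a b :: real
    using sum_squares_bound[of "\<bar>a\<bar>" "\<bar>b\<bar>"] abs_ge_zero[of "a*b"]
    unfolding abs_mult power2_abs by linarith
  then show "AE x in m. norm (f x * g x) \<le> norm ((f x)\<^sup>2 + (g x)\<^sup>2)" by auto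
qed

lemma L2_dominated:
  assumes "g \<in> L2 m" "f \<in> borel_measurable m" "AE x in m. \<bar>f x\<bar> \<le> C * \<bar>g x\<bar>"
  shows "f \<in> L2 m"
proof -
  have "integrable m (\<lambda>x. (f x)\<^sup>2)"
  proof (rule Bochner_Integration.integrable_bound)
    show "integrable m (\<lambda>x. C\<^sup>2 * (g x)\<^sup>2)" using assms by (auto simp: L2_def)
    show "AE x in m. norm ((f x)\<^sup>2) \<le> norm (C\<^sup>2 * (g x)\<^sup>2)"
      using assms(3)
    proof eventually_elim
      case (elim x)
      then have "\<bar>f x\<bar>\<^sup>2 \<le> (C * \<bar>g x\<bar>)\<^sup>2" by (intro power_mono) auto
      then show ?case by (simp add: power_mult_distrib)
    qed
  qed (use assms in auto)
  then show ?thesis using assms by (simp add: L2_def)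
qed

lemma L2_psd_form: "psd_form (L2 m) (l2_inner m)"
proof
  have add: "(\<lambda>x. u x + v x) \<in> L2 m" if "u \<in> L2 m" "v \<in> L2 m" for u v
  proof -
    have "integrable m (\<lambda>x. (u x)\<^sup>2 + (v x)\<^sup>2 + 2 * (u x * v x))"
      using that L2_integrable_mult[OF that] by (auto simp: L2_def)
    then show ?thesis using that by (auto simp: L2_def power2_sum mult.assoc)
  qed
  show "(\<lambda>x. u x + v x) \<in> L2 m" if "u \<in> L2 m" "v \<in> L2 m" for u v by (rule add[OF that])
  show "(\<lambda>x. 0) \<in> L2 m" by (simp add: L2_def)
  show "(\<lambda>x. c * u x) \<in> L2 m" if "u \<in> L2 m" for u c
    using that by (auto simp: L2_def power_mult_distrib)
  fix u v w c assume *: "u \<in> L2 m" "v \<in> L2 m"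
  show "l2_inner m (\<lambda>x. c * u x) v = c * l2_inner m u v"
    by (simp add: l2_inner_def mult.assoc)
  show "l2_inner m u (\<lambda>x. c * v x) = c * l2_inner m u v"
    by (simp add: l2_inner_def mult.left_commute[of _ c])
  assume "w \<in> L2 m"
  note i = L2_integrable_mult[OF *(1) this] L2_integrable_mult[OF *(2) this]
  then show "l2_inner m (\<lambda>x. u x + v x) w = l2_inner m u w + l2_inner m v w"
    by (simp add: l2_inner_def distrib_right)
  from i show "l2_inner m w (\<lambda>x. u x + v x) = l2_inner m w u + l2_inner m w v"
    by (simp add: l2_inner_def distrib_left mult.commute[of "w _"])
qed (simp add: l2_inner_def)

interpretation l2: psd_form "L2 m" "l2_inner m" for m :: "'a measure"
  by (rule L2_psd_form)

lemma l2_inner_commute: "l2_inner m f g = l2_inner m g f"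
  by (simp add: l2_inner_def mult.commute)

lemma l2_norm_nonneg: "0 \<le> l2_norm m f"
  by (simp add: l2_norm_def l2_inner_def)

lemma l2_norm_sq: "(l2_norm m f)\<^sup>2 = l2_inner m f f"
  by (simp add: l2_norm_def l2_inner_def)

lemma l2_cauchy_schwarz:
  assumes "f \<in> L2 m" "g \<in> L2 m"
  shows "\<bar>l2_inner m f g\<bar> \<le> l2_norm m f * l2_norm m g"
proof -
  let ?h = "\<lambda>x. - 1 * g x"
  have "l2_inner m f ?h = - l2_inner m f g" "l2_inner m ?h f = - l2_inner m f g"
    by (simp_all add: l2_inner_def mult.commute)
  then show ?thesis
    using l2.cauchy_schwarz[OF assms] l2.cauchy_schwarz[OF assms(1) l2.scale[OF assms(2)], of "-1"]
      l2.nrm_scale[OF assms(2), of "-1"]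
    by (simp add: l2_inner_commute[of m g f] l2_norm_def)
qed

lemma l2_inner_mono:
  assumes "f \<in> L2 m" "g \<in> L2 m" "h \<in> L2 m" "AE x in m. f x \<le> g x" "AE x in m. 0 \<le> h x"
  shows "l2_inner m f h \<le> l2_inner m g h"
  unfolding l2_inner_def
  by (intro integral_mono_AE L2_integrable_mult assms)
     (use assms(4,5) in \<open>eventually_elim, auto intro: mult_right_mono\<close>)

lemma l2_inner_AE:
  assumes "f \<in> borel_measurable m" "f' \<in> borel_measurable m" "AE x in m. f x = f' x"
    and "g \<in> borel_measurable m" "g' \<in> borel_measurable m" "AE x in m. g x = g' x"
  shows "l2_inner m f g = l2_inner m f' g'"
  unfolding l2_inner_def
  using assms by (intro integral_cong_AE) auto

lemma l2_inner_sq_mono: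
  assumes "g \<in> L2 m" "f \<in> borel_measurable m" "AE x in m. \<bar>f x\<bar> \<le> C * \<bar>g x\<bar>"
  shows "l2_inner m f f \<le> C\<^sup>2 * l2_inner m g g"
proof -
  have f: "f \<in> L2 m" using L2_dominated[OF assms] .
  have "l2_inner m f f \<le> (\<integral>x. C\<^sup>2 * (g x * g x) \<partial>m)"
    unfolding l2_inner_def
  proof (intro integral_mono_AE integrable_mult_right L2_integrable_mult f assms(1))
    show "AE x in m. f x * f x \<le> C\<^sup>2 * (g x * g x)"
      using assms(3)
    proof eventually_elim
      case (elim x)
      then have "\<bar>f x\<bar>\<^sup>2 \<le> (C * \<bar>g x\<bar>)\<^sup>2" by (intro power_mono) auto
      then show ?case by (simp add: power_mult_distrib flip: power2_eq_square)
    qed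
  qed
  then show ?thesis by (simp add: l2_inner_def)
qed

lemma l2_norm_mono:
  assumes "g \<in> L2 m" "f \<in> borel_measurable m" "AE x in m. \<bar>f x\<bar> \<le> \<bar>g x\<bar>"
  shows "l2_norm m f \<le> l2_norm m g"
  using l2_inner_sq_mono[OF assms(1,2), of 1] assms(3) by (simp add: l2_norm_def)

lemma AE_eq_0_of_l2_inner:
  assumes "f \<in> L2 m" "l2_inner m f f \<le> 0"
  shows "AE x in m. f x = 0"
proof -
  have "l2_inner m f f = 0"
    using assms(2) l2.nonneg[OF assms(1)] by (rule antisym)
  then have "(\<integral>x. f x * f x \<partial>m) = 0"
    by (simp only: l2_inner_def)
  then have "AE x in m. f x * f x = 0"
    by (subst (asm) integral_nonneg_eq_0_iff_AE) (auto intro: L2_integrable_mult assms)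
  then show ?thesis by simp
qed

lemma l2_limit_unique:
  assumes w: "\<And>n::nat. w n \<in> L2 m" and f: "f \<in> L2 m" and g: "g \<in> L2 m"
    and "(\<lambda>n. l2_norm m (\<lambda>x. w n x - f x)) \<longlonglongrightarrow> 0"
    and "(\<lambda>n. l2_norm m (\<lambda>x. w n x - g x)) \<longlonglongrightarrow> 0"
  shows "AE x in m. f x = g x"
proof -
  have "l2_norm m (\<lambda>x. f x - g x) \<le> l2_norm m (\<lambda>x. w n x - f x) + l2_norm m (\<lambda>x. w n x - g x)" for n
    using l2.triangle_via[OF f w[of n] g] l2.diff_swap[OF f w[of n]] by (simp add: l2_norm_def)
  then have "l2_norm m (\<lambda>x. f x - g x) \<le> 0"
    using tendsto_lowerbound[OF tendsto_add[OF assms(4,5)]] by (simp add: always_eventually)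
  then have "l2_inner m (\<lambda>x. f x - g x) (\<lambda>x. f x - g x) \<le> 0"
    using l2_norm_sq[of m "\<lambda>x. f x - g x"] l2_norm_nonneg[of m "\<lambda>x. f x - g x"] by simp
  from AE_eq_0_of_l2_inner[OF l2.diff[OF f g] this] show ?thesis by simp
qed

lemma truncation_tendsto_L2:
  assumes u: "u \<in> L2 m"
  shows "(\<lambda>n. l2_norm m (\<lambda>x. max (u x) 0 - min (max (u x) 0) (real n))) \<longlonglongrightarrow> 0"
proof -
  have "(\<lambda>n. \<integral>x. (max (u x) 0 - min (max (u x) 0) (real n))\<^sup>2 \<partial>m) \<longlonglongrightarrow> (\<integral>x. 0 \<partial>m)"
  proof (rule integral_dominated_convergence)
    show "integrable m (\<lambda>x. (u x)\<^sup>2)" using u by (simp add: L2_def)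
    show "AE x in m. (\<lambda>n. (max (u x) 0 - min (max (u x) 0) (real n))\<^sup>2) \<longlonglongrightarrow> 0"
    proof (intro AE_I2 tendsto_eventually)
      fix x
      obtain N where "u x \<le> real N" using real_arch_simple by blast
      then show "\<forall>\<^sub>F n in sequentially. (max (u x) 0 - min (max (u x) 0) (real n))\<^sup>2 = 0"
        unfolding eventually_sequentially
        by (intro exI[of _ N]) (auto simp: min_def max_def)
    qed
    have "\<bar>max a 0 - min (max a 0) (real n)\<bar> \<le> \<bar>a\<bar>" for a n by auto
    then show "AE x in m. norm ((max (u x) 0 - min (max (u x) 0) (real n))\<^sup>2) \<le> (u x)\<^sup>2" for n
      unfolding abs_le_square_iff by simp
  qed (use L2_measurable[OF u] in \<open>auto intro!: measurable\<close>)
  then have "(\<lambda>n. sqrt (\<integral>x. (max (u x) 0 - min (max (u x) 0) (real n))\<^sup>2 \<partial>m)) \<longlonglongrightarrow> sqrt 0"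
    by (intro tendsto_real_sqrt) simp
  then show ?thesis by (simp add: l2_norm_def l2_inner_def power2_eq_square)
qed

lemma tendsto_0_of_le_sqrt_inverse:
  fixes a :: "nat \<Rightarrow> real"
  assumes "\<And>n. 0 \<le> a n" "\<And>n. a n \<le> sqrt (inverse (real (Suc n)))"
  shows "a \<longlonglongrightarrow> 0"
proof (rule Lim_null_comparison[OF always_eventually], rule allI)
  show "norm (a n) \<le> sqrt (inverse (real (Suc n)))" for n using assms[of n] by (simp del: of_nat_Suc)
  show "(\<lambda>n. sqrt (inverse (real (Suc n)))) \<longlonglongrightarrow> 0"
    using tendsto_real_sqrt[OF LIMSEQ_inverse_real_of_nat] by (simp del: of_nat_Suc)
qed

section \<open>Coercive closed forms\<close>

text \<open>The axioms of a Dirichlet form other than density and the Markovian property. This is what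
  passes to closed subspaces of the domain before anything is known about contractions.\<close>

locale closed_form =
  fixes m :: "'a measure" and \<E> :: "'a form" and \<F> :: "('a \<Rightarrow> real) set"
  assumes dom_L2: "\<F> \<subseteq> L2 m"
    and dom_AE: "\<lbrakk>f \<in> \<F>; g \<in> borel_measurable m; AE x in m. f x = g x\<rbrakk> \<Longrightarrow> g \<in> \<F>"
    and psd: "psd_form \<F> \<E>"
    and form_AE: "\<lbrakk>f \<in> \<F>; f' \<in> \<F>; g \<in> \<F>; g' \<in> \<F>;
        AE x in m. f x = f' x; AE x in m. g x = g' x\<rbrakk> \<Longrightarrow> \<E> f g = \<E> f' g'"
    and form_closed: "\<lbrakk>\<And>n. w n \<in> \<F>;
        \<forall>\<epsilon>>0. \<exists>N. \<forall>i\<ge>N. \<forall>j\<ge>N. E1_norm m \<E> (\<lambda>x. w i x - w j x) < \<epsilon>\<rbrakk>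
      \<Longrightarrow> \<exists>f\<in>\<F>. (\<lambda>n::nat. E1_norm m \<E> (\<lambda>x. w n x - f x)) \<longlonglongrightarrow> 0"
    and sector: "\<exists>K. \<forall>u\<in>\<F>. \<forall>v\<in>\<F>.
        \<bar>form_shift m \<E> 1 u v\<bar> \<le> K * E1_norm m \<E> u * E1_norm m \<E> v"
begin

sublocale E: psd_form \<F> \<E> by (rule psd)

lemma in_L2: "f \<in> \<F> \<Longrightarrow> f \<in> L2 m" using dom_L2 by blast

lemma in_measurable: "f \<in> \<F> \<Longrightarrow> f \<in> borel_measurable m" using in_L2 L2_measurable by blast

sublocale E1: psd_form \<F> "form_shift m \<E> 1"
proof
  show "(\<lambda>x. 0) \<in> \<F>" by (rule E.zero)
qed (auto simp: form_shift_def E.bilinear l2.bilinear in_L2 E.nonneg l2.nonneg algebra_simps)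

lemma E1_norm_sq: "u \<in> \<F> \<Longrightarrow> (E1_norm m \<E> u)\<^sup>2 = \<E> u u + (l2_norm m u)\<^sup>2"
  using E1.nonneg[of u] by (simp add: E1_norm_def form_shift_def l2_norm_sq)

lemma E1_norm_nonneg: "u \<in> \<F> \<Longrightarrow> 0 \<le> E1_norm m \<E> u"
  unfolding E1_norm_def by (rule E1.nrm_nonneg)

lemma l2_norm_le_E1_norm: "u \<in> \<F> \<Longrightarrow> l2_norm m u \<le> E1_norm m \<E> u"
  using E1_norm_sq[of u] E1_norm_nonneg[of u] E.nonneg[of u]
  by (intro power2_le_imp_le[of "l2_norm m u"]) auto

lemma energy_le_E1_norm: "u \<in> \<F> \<Longrightarrow> \<E> u u \<le> (E1_norm m \<E> u)\<^sup>2"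
  using E1_norm_sq[of u] by simp

lemma shifted_energy_le:
  assumes "u \<in> \<F>" "\<E> u u \<le> M" "l2_norm m u \<le> r"
  shows "form_shift m \<E> 1 u u \<le> M + r\<^sup>2"
proof -
  have "(l2_norm m u)\<^sup>2 \<le> r\<^sup>2" using assms(3) l2_norm_nonneg by (intro power_mono) auto
  then show ?thesis using assms(2) by (simp add: form_shift_def flip: l2_norm_sq)
qed

lemma E1_norm_AE:
  assumes "f \<in> \<F>" "g \<in> \<F>" "AE x in m. f x = g x"
  shows "E1_norm m \<E> f = E1_norm m \<E> g"
  using form_AE[OF assms(1,2,1,2,3,3)] l2_inner_AE[of f m g f g] assms in_measurable
  by (simp add: E1_norm_def form_shift_def)

lemma sector_const:
  obtains K where "0 \<le> K" "\<And>u v. \<lbrakk>u \<in> \<F>; v \<in> \<F>\<rbrakk> \<Longrightarrow>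
    \<bar>form_shift m \<E> 1 u v\<bar> \<le> K * E1_norm m \<E> u * E1_norm m \<E> v"
proof -
  obtain K where K: "\<And>u v. \<lbrakk>u \<in> \<F>; v \<in> \<F>\<rbrakk> \<Longrightarrow>
      \<bar>form_shift m \<E> 1 u v\<bar> \<le> K * E1_norm m \<E> u * E1_norm m \<E> v"
    using sector by blast
  have "\<bar>form_shift m \<E> 1 u v\<bar> \<le> \<bar>K\<bar> * E1_norm m \<E> u * E1_norm m \<E> v"
    if uv: "u \<in> \<F>" "v \<in> \<F>" for u v
  proof -
    have "K * (E1_norm m \<E> u * E1_norm m \<E> v) \<le> \<bar>K\<bar> * (E1_norm m \<E> u * E1_norm m \<E> v)"
      using E1_norm_nonneg uv by (intro mult_right_mono) auto
    then show ?thesis using K[OF uv] by (simp add: mult.assoc)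
  qed
  then show ?thesis using that[of "\<bar>K\<bar>"] by simp
qed

lemma l2_tendsto_of_E1:
  assumes "\<And>n::nat. w n \<in> \<F>" "f \<in> \<F>" "(\<lambda>n. E1_norm m \<E> (\<lambda>x. w n x - f x)) \<longlonglongrightarrow> 0"
  shows "(\<lambda>n. l2_norm m (\<lambda>x. w n x - f x)) \<longlonglongrightarrow> 0"
proof (rule Lim_null_comparison[OF always_eventually assms(3)], rule allI)
  show "norm (l2_norm m (\<lambda>x. w n x - f x)) \<le> E1_norm m \<E> (\<lambda>x. w n x - f x)" for n
    using l2_norm_le_E1_norm[OF E.diff[OF assms(1,2)], of n] l2_norm_nonneg[of m "\<lambda>x. w n x - f x"]
    by simp
qed

lemma form_tendsto:
  assumes "\<And>n::nat. a n \<in> \<F>" "\<And>n. b n \<in> \<F>" "f \<in> \<F>" "g \<in> \<F>"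
    and "(\<lambda>n. E1_norm m \<E> (\<lambda>x. a n x - f x)) \<longlonglongrightarrow> 0"
    and "(\<lambda>n. E1_norm m \<E> (\<lambda>x. b n x - g x)) \<longlonglongrightarrow> 0"
  shows "(\<lambda>n. \<E> (a n) (b n)) \<longlonglongrightarrow> \<E> f g"
proof -
  obtain K where K: "\<And>u v. \<lbrakk>u \<in> \<F>; v \<in> \<F>\<rbrakk> \<Longrightarrow>
      \<bar>form_shift m \<E> 1 u v\<bar> \<le> K * E1_norm m \<E> u * E1_norm m \<E> v"
    using sector_const by metis
  have "(\<lambda>n. form_shift m \<E> 1 (a n) (b n)) \<longlonglongrightarrow> form_shift m \<E> 1 f g"
    using assms K unfolding E1_norm_def by (intro E1.tendsto_of_bounded[of K])
  moreover have "(\<lambda>n. l2_inner m (a n) (b n)) \<longlonglongrightarrow> l2_inner m f g"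
  proof (rule l2.tendsto_of_bounded[of m 1])
    show "(\<lambda>n. l2.nrm m (\<lambda>x. a n x - f x)) \<longlonglongrightarrow> 0" "(\<lambda>n. l2.nrm m (\<lambda>x. b n x - g x)) \<longlonglongrightarrow> 0"
      using l2_tendsto_of_E1[OF assms(1,3,5)] l2_tendsto_of_E1[OF assms(2,4,6)]
      by (simp_all only: l2_norm_def)
  qed (use l2_cauchy_schwarz[of _ m] assms in_L2 in \<open>auto simp: l2_norm_def\<close>)
  ultimately have "(\<lambda>n. form_shift m \<E> 1 (a n) (b n) - l2_inner m (a n) (b n))
      \<longlonglongrightarrow> form_shift m \<E> 1 f g - l2_inner m f g" by (rule tendsto_diff)
  then show ?thesis by (simp add: form_shift_def)
qed

text \<open>The limit given by closedness is identified by its \<open>L\<^sup>2\<close>-limit, since the \<open>\<E>\<^sub>1\<close>-norm is the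
  stronger norm.\<close>

lemma closed_L2_limit:
  assumes w: "\<And>n::nat. w n \<in> \<F>"
    and Cauchy: "\<forall>\<epsilon>>0. \<exists>N. \<forall>i\<ge>N. \<forall>j\<ge>N. E1_norm m \<E> (\<lambda>x. w i x - w j x) < \<epsilon>"
    and f: "f \<in> L2 m" and lim: "(\<lambda>n. l2_norm m (\<lambda>x. w n x - f x)) \<longlonglongrightarrow> 0"
  shows "f \<in> \<F>" "(\<lambda>n. E1_norm m \<E> (\<lambda>x. w n x - f x)) \<longlonglongrightarrow> 0"
proof -
  obtain h where h: "h \<in> \<F>" "(\<lambda>n. E1_norm m \<E> (\<lambda>x. w n x - h x)) \<longlonglongrightarrow> 0"
    using form_closed[OF w Cauchy] by blast
  have ae: "AE x in m. h x = f x"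
    using l2_limit_unique[OF in_L2[OF w] in_L2[OF h(1)] f l2_tendsto_of_E1[OF w h] lim] .
  then show fF: "f \<in> \<F>" using dom_AE h(1) L2_measurable[OF f] by blast
  have "E1_norm m \<E> (\<lambda>x. w n x - h x) = E1_norm m \<E> (\<lambda>x. w n x - f x)" for n
    using ae by (intro E1_norm_AE E.diff w h(1) fF) auto
  with h(2) show "(\<lambda>n. E1_norm m \<E> (\<lambda>x. w n x - f x)) \<longlonglongrightarrow> 0" by simp
qed

text \<open>A Fatou lemma. Almost minimal elements of the convex sets of functions of energy at most
  \<open>M\<close> that are closer and closer to \<open>u\<close> in \<open>L\<^sup>2\<close> converge in the \<open>\<E>\<^sub>1\<close>-norm, and \<open>u\<close> is the
  only possible limit.\<close>

lemma bounded_energy_L2_limit: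
  assumes u: "u \<in> L2 m"
    and approx: "\<And>\<epsilon>. \<epsilon> > 0 \<Longrightarrow> \<exists>w\<in>\<F>. l2_norm m (\<lambda>x. u x - w x) < \<epsilon> \<and> \<E> w w \<le> M"
  shows "u \<in> \<F> \<and> \<E> u u \<le> M"
proof -
  define S where "S n = {w \<in> \<F>. l2_inner m (\<lambda>x. u x - w x) (\<lambda>x. u x - w x) \<le> inverse (real (Suc n))
    \<and> \<E> w w \<le> M}" for n
  have "\<exists>w. (\<forall>n. w n \<in> S n) \<and> (\<forall>\<epsilon>>0. \<exists>N. \<forall>i\<ge>N. \<forall>j\<ge>N. E1.nrm (\<lambda>x. w i x - w j x) < \<epsilon>)"
  proof (rule E1.Cauchy_minimisers)
    show "S n \<subseteq> \<F>" for n by (auto simp: S_def)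
    show "S k \<subseteq> S n" if "n \<le> k" for n k
    proof -
      have "inverse (real (Suc k)) \<le> inverse (real (Suc n))"
        using that by (intro le_imp_inverse_le) auto
      from order_trans[OF _ this] show ?thesis unfolding S_def by blast
    qed
    show "(\<lambda>x. (w x + v x) / 2) \<in> S n" if "w \<in> S n" "v \<in> S n" for n w v
    proof -
      have "(\<lambda>x. u x - (w x + v x) / 2) = (\<lambda>x. ((u x - w x) + (u x - v x)) / 2)"
        by (auto simp: field_simps)
      then show ?thesis
        using that l2.midpoint_le[OF l2.diff l2.diff, of u m w u v] u E.midpoint[of w v]
          E.midpoint_le[of w v M] in_L2 unfolding S_def by auto
    qed
    show "\<exists>w\<in>S n. form_shift m \<E> 1 w w \<le> M + (l2_norm m u + 1)\<^sup>2" for n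
    proof -
      define e where "e = inverse (real (Suc n))"
      have e: "0 < e" "e \<le> 1" by (auto simp: e_def field_simps)
      obtain w where w: "w \<in> \<F>" "l2_norm m (\<lambda>x. u x - w x) < e" "\<E> w w \<le> M"
        using approx[OF e(1)] by blast
      have "l2_norm m w \<le> l2_norm m u + 1"
        using l2.nrm_le_approx[OF u in_L2[OF w(1)]] w(2) e by (simp add: l2_norm_def)
      then have 1: "form_shift m \<E> 1 w w \<le> M + (l2_norm m u + 1)\<^sup>2"
        using shifted_energy_le w by blast
      have "(l2_norm m (\<lambda>x. u x - w x))\<^sup>2 \<le> e\<^sup>2"
        using w(2) l2_norm_nonneg by (intro power_mono) auto
      also have "\<dots> \<le> e" using e by (simp add: power2_eq_square mult_left_le)
      finally show ?thesis using 1 w by (auto simp: S_def e_def l2_norm_sq)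
    qed
  qed
  then obtain w where w: "\<And>n. w n \<in> S n"
    and Cauchy: "\<forall>\<epsilon>>0. \<exists>N. \<forall>i\<ge>N. \<forall>j\<ge>N. E1_norm m \<E> (\<lambda>x. w i x - w j x) < \<epsilon>"
    unfolding E1_norm_def by blast
  have wF: "w n \<in> \<F>" for n using w[of n] by (simp add: S_def)
  have le: "l2_norm m (\<lambda>x. w n x - u x) \<le> sqrt (inverse (real (Suc n)))" for n
    using w[of n] l2.diff_swap[OF u in_L2[OF wF[of n]]] by (simp add: S_def l2_norm_def)
  have lim: "(\<lambda>n. l2_norm m (\<lambda>x. w n x - u x)) \<longlonglongrightarrow> 0"
    using le l2_norm_nonneg by (intro tendsto_0_of_le_sqrt_inverse) (simp_all del: of_nat_Suc)
  note c = closed_L2_limit[OF wF Cauchy u lim]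
  have "(\<lambda>n. \<E> (w n) (w n)) \<longlonglongrightarrow> \<E> u u" using form_tendsto[OF wF wF c(1,1,2,2)] .
  moreover have "\<E> (w n) (w n) \<le> M" for n using w[of n] by (simp add: S_def)
  ultimately have "\<E> u u \<le> M" by (intro LIMSEQ_le_const2) auto
  with c(1) show ?thesis by simp
qed

text \<open>Bounded energy and convergence to zero in \<open>L\<^sup>2\<close> imply weak convergence to zero, by the same
  minimisation: otherwise the convex sets of functions that are small in \<open>L\<^sup>2\<close> and lie in the
  half-space \<open>\<E>\<^sub>1(\<cdot>, v) \<ge> \<delta>\<close> all contain functions of energy at most \<open>M\<close>, and their almost
  minimal elements converge in the \<open>\<E>\<^sub>1\<close>-norm to zero, which is outside the half-space.\<close>

lemma weakly_small:
  assumes v: "v \<in> \<F>" and \<delta>: "\<delta> > 0"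
  shows "\<exists>\<eta>>0. \<forall>w\<in>\<F>. \<E> w w \<le> M \<longrightarrow> l2_norm m w < \<eta> \<longrightarrow> form_shift m \<E> 1 w v < \<delta>"
proof (rule ccontr)
  assume "\<not> ?thesis"
  then have ex: "\<exists>w\<in>\<F>. \<E> w w \<le> M \<and> l2_norm m w < \<eta> \<and> form_shift m \<E> 1 w v \<ge> \<delta>" if "\<eta> > 0" for \<eta>
    using that by (meson not_less)
  define S where "S n = {w \<in> \<F>. l2_inner m w w \<le> inverse (real (Suc n)) \<and> \<delta> \<le> form_shift m \<E> 1 w v}" for n
  have "\<exists>w. (\<forall>n. w n \<in> S n) \<and> (\<forall>\<epsilon>>0. \<exists>N. \<forall>i\<ge>N. \<forall>j\<ge>N. E1.nrm (\<lambda>x. w i x - w j x) < \<epsilon>)"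
  proof (rule E1.Cauchy_minimisers)
    show "S n \<subseteq> \<F>" for n by (auto simp: S_def)
    show "S k \<subseteq> S n" if "n \<le> k" for n k
    proof -
      have "inverse (real (Suc k)) \<le> inverse (real (Suc n))"
        using that by (intro le_imp_inverse_le) auto
      from order_trans[OF _ this] show ?thesis unfolding S_def by blast
    qed
    show "(\<lambda>x. (u x + w x) / 2) \<in> S n" if "u \<in> S n" "w \<in> S n" for n u w
    proof -
      have "form_shift m \<E> 1 (\<lambda>x. (1/2) * (u x + w x)) v = (form_shift m \<E> 1 u v + form_shift m \<E> 1 w v) / 2"
        using that v unfolding S_def by (subst E1.scale_left) (auto simp: E1.bilinear)
      then show ?thesis
        using that l2.midpoint_le[of u m w] E.midpoint[of u w] in_L2 unfolding S_def by auto
    qed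
    show "\<exists>w\<in>S n. form_shift m \<E> 1 w w \<le> M + 1\<^sup>2" for n
    proof -
      define e where "e = inverse (real (Suc n))"
      have e: "0 < e" "e \<le> 1" by (auto simp: e_def field_simps)
      obtain w where w: "w \<in> \<F>" "\<E> w w \<le> M" "l2_norm m w < e" "\<delta> \<le> form_shift m \<E> 1 w v"
        using ex[OF e(1)] by blast
      have 1: "form_shift m \<E> 1 w w \<le> M + 1\<^sup>2"
        using w e by (intro shifted_energy_le) auto
      have "(l2_norm m w)\<^sup>2 \<le> e\<^sup>2"
        using w(3) l2_norm_nonneg by (intro power_mono) auto
      also have "\<dots> \<le> e" using e by (simp add: power2_eq_square mult_left_le)
      finally show ?thesis using 1 w by (auto simp: S_def e_def l2_norm_sq)
    qed
  qed
  then obtain w where w: "\<And>n. w n \<in> S n"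
    and Cauchy: "\<forall>\<epsilon>>0. \<exists>N. \<forall>i\<ge>N. \<forall>j\<ge>N. E1_norm m \<E> (\<lambda>x. w i x - w j x) < \<epsilon>"
    unfolding E1_norm_def by blast
  have wF: "w n \<in> \<F>" for n using w[of n] by (simp add: S_def)
  have le: "l2_norm m (w n) \<le> sqrt (inverse (real (Suc n)))" for n
    using w[of n] by (simp add: S_def l2_norm_def)
  have lim: "(\<lambda>n. l2_norm m (\<lambda>x. w n x - (\<lambda>x. 0) x)) \<longlonglongrightarrow> 0"
    using le l2_norm_nonneg by (intro tendsto_0_of_le_sqrt_inverse) (simp_all del: of_nat_Suc)
  have lim1: "(\<lambda>n. E1_norm m \<E> (w n)) \<longlonglongrightarrow> 0"
    using closed_L2_limit(2)[OF wF Cauchy l2.zero lim] by simp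
  obtain K where K: "\<And>u v. \<lbrakk>u \<in> \<F>; v \<in> \<F>\<rbrakk> \<Longrightarrow>
      \<bar>form_shift m \<E> 1 u v\<bar> \<le> K * E1_norm m \<E> u * E1_norm m \<E> v"
    using sector_const by metis
  have "\<delta> \<le> K * E1_norm m \<E> (w n) * E1_norm m \<E> v" for n
    using K[OF wF[of n] v] w[of n] unfolding S_def by simp linarith
  moreover have "(\<lambda>n. K * E1_norm m \<E> (w n) * E1_norm m \<E> v) \<longlonglongrightarrow> K * 0 * E1_norm m \<E> v"
    by (intro tendsto_intros lim1)
  ultimately have "\<delta> \<le> K * 0 * E1_norm m \<E> v" by (intro LIMSEQ_le_const) auto
  with \<delta> show False by simp
qed

lemma weak_tendsto:
  assumes w: "\<And>n::nat. w n \<in> \<F>" and f: "f \<in> \<F>" and v: "v \<in> \<F>"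
    and bd: "\<And>n. \<E> (w n) (w n) \<le> M"
    and lim: "(\<lambda>n. l2_norm m (\<lambda>x. w n x - f x)) \<longlonglongrightarrow> 0"
  shows "(\<lambda>n. \<E> (w n) v) \<longlonglongrightarrow> \<E> f v"
proof -
  let ?d = "\<lambda>n x. w n x - f x"
  have d: "?d n \<in> \<F>" for n using w f by (intro E.diff)
  have bd': "\<E> (?d n) (?d n) \<le> (sqrt M + E.nrm f)\<^sup>2" for n
  proof -
    have "E.nrm (?d n) \<le> sqrt M + E.nrm f"
      using E.triangle_diff[OF w f, of n] bd[of n] real_sqrt_le_mono[OF bd[of n]] by linarith
    then have "(E.nrm (?d n))\<^sup>2 \<le> (sqrt M + E.nrm f)\<^sup>2"
      using E.nrm_nonneg[OF d] by (intro power_mono)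
    then show ?thesis unfolding E.nrm_sq[OF d] .
  qed
  have "(\<lambda>n. form_shift m \<E> 1 (?d n) v) \<longlonglongrightarrow> 0"
  proof (rule tendstoI)
    fix \<delta> :: real assume \<delta>: "\<delta> > 0"
    obtain \<eta> where \<eta>: "\<eta> > 0"
      "\<And>w. \<lbrakk>w \<in> \<F>; \<E> w w \<le> (sqrt M + E.nrm f)\<^sup>2; l2_norm m w < \<eta>\<rbrakk> \<Longrightarrow> form_shift m \<E> 1 w v < \<delta>"
      using weakly_small[OF v \<delta>, of "(sqrt M + E.nrm f)\<^sup>2"] by blast
    have "\<forall>\<^sub>F n in sequentially. l2_norm m (?d n) < \<eta>"
      using order_tendstoD(2)[OF lim \<eta>(1)] .
    then show "\<forall>\<^sub>F n in sequentially. dist (form_shift m \<E> 1 (?d n) v) 0 < \<delta>"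
    proof eventually_elim
      case (elim n)
      have "form_shift m \<E> 1 (\<lambda>x. - 1 * ?d n x) v < \<delta>"
      proof (rule \<eta>(2))
        show "(\<lambda>x. - 1 * ?d n x) \<in> \<F>" using d by (rule E.scale)
        have "\<E> (\<lambda>x. - 1 * ?d n x) (\<lambda>x. - 1 * ?d n x) = \<E> (?d n) (?d n)"
          using d[of n] E.scale[OF d[of n], of "-1"] by (simp only: E.scale_left E.scale_right)
        then show "\<E> (\<lambda>x. - 1 * ?d n x) (\<lambda>x. - 1 * ?d n x) \<le> (sqrt M + E.nrm f)\<^sup>2" using bd' by simp
        show "l2_norm m (\<lambda>x. - 1 * ?d n x) < \<eta>"
          using elim l2.nrm_scale[OF in_L2[OF d[of n]], of "-1"] unfolding l2_norm_def by linarith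
      qed
      moreover have "form_shift m \<E> 1 (\<lambda>x. - 1 * ?d n x) v = - form_shift m \<E> 1 (?d n) v"
        using E1.scale_left[OF d v, of "-1"] by simp
      ultimately show ?case using \<eta>(2)[OF d bd' elim] by (auto simp: dist_real_def)
    qed
  qed
  moreover have "(\<lambda>n. l2_inner m (?d n) v) \<longlonglongrightarrow> 0"
  proof (rule Lim_null_comparison)
    show "\<forall>\<^sub>F n in sequentially. norm (l2_inner m (?d n) v) \<le> l2_norm m (?d n) * l2_norm m v"
      using l2_cauchy_schwarz[OF in_L2[OF d] in_L2[OF v]] by auto
    show "(\<lambda>n. l2_norm m (?d n) * l2_norm m v) \<longlonglongrightarrow> 0"
      using tendsto_mult[OF lim tendsto_const[of "l2_norm m v"]] by simp
  qed
  ultimately have "(\<lambda>n. form_shift m \<E> 1 (?d n) v - l2_inner m (?d n) v) \<longlonglongrightarrow> 0 - 0"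
    by (rule tendsto_diff)
  then have "(\<lambda>n. \<E> (w n) v - \<E> f v) \<longlonglongrightarrow> 0"
    using w f v by (simp add: form_shift_def E.bilinear)
  then show ?thesis by (rule LIM_zero_cancel)
qed

end

section \<open>Resolvents and approximating forms\<close>

context closed_form
begin

text \<open>A relation rather than an operator \<open>G\<^sub>\<alpha>\<close>: a resolvent is determined only up to equality almost
  everywhere.\<close>

definition is_resolvent :: "real \<Rightarrow> ('a \<Rightarrow> real) \<Rightarrow> ('a \<Rightarrow> real) \<Rightarrow> bool" where
  "is_resolvent \<alpha> f w \<longleftrightarrow> w \<in> \<F> \<and> (\<forall>v\<in>\<F>. form_shift m \<E> \<alpha> w v = l2_inner m f v)"

lemma is_resolvent_add:
  assumes "is_resolvent \<alpha> f u" "is_resolvent \<alpha> g v" "f \<in> L2 m" "g \<in> L2 m"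
  shows "is_resolvent \<alpha> (\<lambda>x. f x + g x) (\<lambda>x. u x + v x)"
  unfolding is_resolvent_def
proof (intro conjI ballI)
  have uv: "u \<in> \<F>" "v \<in> \<F>" using assms by (auto simp: is_resolvent_def)
  then show "(\<lambda>x. u x + v x) \<in> \<F>" by (rule E.add)
  fix h assume h: "h \<in> \<F>"
  have "form_shift m \<E> \<alpha> u h = l2_inner m f h" "form_shift m \<E> \<alpha> v h = l2_inner m g h"
    using assms(1,2) h by (auto simp: is_resolvent_def)
  then show "form_shift m \<E> \<alpha> (\<lambda>x. u x + v x) h = l2_inner m (\<lambda>x. f x + g x) h"
    using uv h assms(3,4) in_L2 by (simp add: form_shift_def E.add_left l2.add_left distrib_left)
qed

text \<open>The approximating form \<open>\<E>\<^bsup>(\<alpha>)\<^esup>(f, g)\<close> when \<open>w\<close> is a resolvent \<open>G\<^sub>\<alpha> f\<close>.\<close>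

definition approx_form :: "real \<Rightarrow> ('a \<Rightarrow> real) \<Rightarrow> ('a \<Rightarrow> real) \<Rightarrow> ('a \<Rightarrow> real) \<Rightarrow> real" where
  "approx_form \<alpha> w f g = \<alpha> * l2_inner m (\<lambda>x. f x - \<alpha> * w x) g"

lemma approx_form_eq:
  assumes "is_resolvent \<alpha> f w" "f \<in> L2 m" "g \<in> \<F>"
  shows "approx_form \<alpha> w f g = \<E> (\<lambda>x. \<alpha> * w x) g"
proof -
  have w: "w \<in> \<F>" and *: "\<E> w g + \<alpha> * l2_inner m w g = l2_inner m f g"
    using assms by (auto simp: is_resolvent_def form_shift_def)
  show ?thesis
    using w assms(2,3) in_L2
    by (simp add: approx_form_def l2.bilinear E.scale_left flip: *)
qed

text \<open>The energy and the squared distance are nonnegative, so \<open>\<E>\<^bsup>(\<alpha>)\<^esup>(f, f)\<close> bounds the energy of \<open>\<alpha> G\<^sub>\<alpha> f\<close> as well as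
  \<open>\<alpha>\<close> times the squared distance of \<open>\<alpha> G\<^sub>\<alpha> f\<close> from \<open>f\<close>.\<close>

lemma energy_resolvent:
  assumes "is_resolvent \<alpha> f w" "f \<in> L2 m"
  shows "\<E> (\<lambda>x. \<alpha> * w x) (\<lambda>x. \<alpha> * w x)
    = approx_form \<alpha> w f f - \<alpha> * l2_inner m (\<lambda>x. f x - \<alpha> * w x) (\<lambda>x. f x - \<alpha> * w x)"
proof -
  have w: "w \<in> \<F>" using assms(1) by (simp add: is_resolvent_def)
  have aw: "(\<lambda>x. \<alpha> * w x) \<in> L2 m" using in_L2[OF E.scale[OF w]] .
  have "\<E> (\<lambda>x. \<alpha> * w x) (\<lambda>x. \<alpha> * w x) = approx_form \<alpha> w f (\<lambda>x. \<alpha> * w x)"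
    using approx_form_eq[OF assms E.scale[OF w]] by simp
  then show ?thesis
    unfolding approx_form_def l2.diff_right[OF assms(2) aw l2.diff[OF assms(2) aw]]
    by (simp add: algebra_simps)
qed

text \<open>The functions \<open>\<alpha> G\<^sub>\<alpha> f\<close> have energy at most \<open>M\<close> and squared distance at most \<open>M / \<alpha>\<close> from \<open>f\<close>, so
  the Fatou lemma applies.\<close>

lemma in_domain_if_approx_bounded:
  assumes f: "f \<in> L2 m"
    and bd: "\<And>\<alpha>. \<alpha> > 0 \<Longrightarrow> \<exists>w. is_resolvent \<alpha> f w \<and> approx_form \<alpha> w f f \<le> M"
  shows "f \<in> \<F>"
proof -
  have "f \<in> \<F> \<and> \<E> f f \<le> M"
  proof (rule bounded_energy_L2_limit[OF f])
    fix \<epsilon> :: real assume "\<epsilon> > 0"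
    \<comment> \<open>large enough that \<open>M / \<alpha> < \<epsilon>\<^sup>2\<close>, whatever the sign of \<open>M\<close>\<close>
    define \<alpha> where "\<alpha> = (\<bar>M\<bar> + 1) / \<epsilon>\<^sup>2"
    have \<alpha>: "\<alpha> > 0" using \<open>\<epsilon> > 0\<close> by (auto simp: \<alpha>_def intro!: divide_pos_pos)
    obtain w where w: "is_resolvent \<alpha> f w" "approx_form \<alpha> w f f \<le> M" using bd[OF \<alpha>] by blast
    have aw: "(\<lambda>x. \<alpha> * w x) \<in> \<F>" using w(1) by (auto simp: is_resolvent_def intro: E.scale)
    have d: "(\<lambda>x. f x - \<alpha> * w x) \<in> L2 m" using f in_L2[OF aw] by (rule l2.diff)
    note eq = energy_resolvent[OF w(1) f]
    have "\<alpha> * l2_inner m (\<lambda>x. f x - \<alpha> * w x) (\<lambda>x. f x - \<alpha> * w x) \<le> M"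
      using eq w(2) E.nonneg[OF aw] by linarith
    also have "M < \<alpha> * \<epsilon>\<^sup>2" using \<open>\<epsilon> > 0\<close> by (simp add: \<alpha>_def)
    finally have "l2_inner m (\<lambda>x. f x - \<alpha> * w x) (\<lambda>x. f x - \<alpha> * w x) < \<epsilon>\<^sup>2" using \<alpha> by simp
    then have "l2_norm m (\<lambda>x. f x - \<alpha> * w x) < \<epsilon>"
      unfolding l2_norm_def using \<open>\<epsilon> > 0\<close> by (intro real_less_lsqrt) auto
    moreover have "\<E> (\<lambda>x. \<alpha> * w x) (\<lambda>x. \<alpha> * w x) \<le> M"
      using eq w(2) l2.nonneg[OF d] \<alpha> by (smt (verit) mult_nonneg_nonneg)
    ultimately show "\<exists>w\<in>\<F>. l2_norm m (\<lambda>x. f x - w x) < \<epsilon> \<and> \<E> w w \<le> M"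
      by (intro bexI[OF _ aw] conjI)
  qed
  then show ?thesis by simp
qed

lemma quadratic_bound:
  fixes y K F :: real
  assumes "0 \<le> K" "0 \<le> F" "y\<^sup>2 \<le> K * y * F + 2 * F\<^sup>2"
  shows "y \<le> (K + 2) * F"
proof (rule ccontr)
  assume "\<not> ?thesis"
  then have y: "(K + 2) * F < y" by simp
  have "F \<le> (K + 2) * F" using assms(1,2) mult_right_mono[of 1 "K + 2" F] by simp
  then have "F < y" "0 < y" using y assms(2) by auto
  have "K * y * F + 2 * F\<^sup>2 \<le> K * y * F + 2 * F * y"
    using \<open>F < y\<close> assms(2) by (simp add: power2_eq_square mult_left_mono)
  also have "\<dots> = ((K + 2) * F) * y" by (simp add: algebra_simps)
  also have "\<dots> < y\<^sup>2" using mult_strict_right_mono[OF y \<open>0 < y\<close>] by (simp add: power2_eq_square)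
  finally show False using assms(3) by simp
qed

text \<open>Without symmetry \<open>\<E>\<^bsup>(\<alpha>)\<^esup>(f, f)\<close> need not increase in \<open>\<alpha>\<close>. The bound comes from
  \<open>\<E>\<^bsup>(\<alpha>)\<^esup>(f, f) = \<E>(\<alpha> G\<^sub>\<alpha> f, f)\<close> and the sector condition: the energy of \<open>\<alpha> G\<^sub>\<alpha> f\<close> is itself at most
  \<open>\<E>\<^bsup>(\<alpha>)\<^esup>(f, f)\<close>, so \<open>y\<^sup>2 = \<E>\<^bsup>(\<alpha>)\<^esup>(f, f) + \<parallel>f\<parallel>\<^sup>2\<close>, with the \<open>\<E>\<^sub>1\<close>-norm of \<open>f\<close>, satisfies a quadratic inequality
  whose coefficients do not depend on \<open>\<alpha>\<close>.\<close>

lemma approx_form_bounded: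
  assumes f: "f \<in> \<F>"
  shows "\<exists>M. \<forall>\<alpha>>0. \<forall>w. is_resolvent \<alpha> f w \<longrightarrow> approx_form \<alpha> w f f \<le> M"
proof -
  obtain K where K: "0 \<le> K" "\<And>u v. \<lbrakk>u \<in> \<F>; v \<in> \<F>\<rbrakk> \<Longrightarrow>
      \<bar>form_shift m \<E> 1 u v\<bar> \<le> K * E1_norm m \<E> u * E1_norm m \<E> v"
    using sector_const by metis
  have "approx_form \<alpha> w f f \<le> ((K + 2) * E1_norm m \<E> f)\<^sup>2"
    if \<alpha>: "\<alpha> > 0" and w: "is_resolvent \<alpha> f w" for \<alpha> w
  proof -
    let ?u = "\<lambda>x. \<alpha> * w x"
    let ?c = "approx_form \<alpha> w f f"
    let ?F = "E1_norm m \<E> f"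
    let ?q = "l2_inner m (\<lambda>x. f x - \<alpha> * w x) (\<lambda>x. f x - \<alpha> * w x)"
    have u: "?u \<in> \<F>" using w by (auto simp: is_resolvent_def intro: E.scale)
    have fL: "f \<in> L2 m" and uL: "?u \<in> L2 m" using f u in_L2 by auto
    have F0: "0 \<le> ?F" and fF: "l2_norm m f \<le> ?F"
      using E1_norm_nonneg[OF f] l2_norm_le_E1_norm[OF f] by auto
    have fF2: "(l2_norm m f)\<^sup>2 \<le> ?F\<^sup>2" using fF l2_norm_nonneg by (intro power_mono)
    note eq = energy_resolvent[OF w fL]
    have q0: "0 \<le> ?q" using l2.nonneg[OF l2.diff[OF fL uL]] .
    have Eu: "\<E> ?u ?u \<le> ?c" using eq q0 \<alpha> by (smt (verit) mult_nonneg_nonneg)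
    have c0: "0 \<le> ?c" using Eu E.nonneg[OF u] by linarith
    have "0 \<le> \<alpha> * l2_inner m (\<lambda>x. f x - \<alpha> * w x) ?u"
      using approx_form_eq[OF w fL u] E.nonneg[OF u] by (simp add: approx_form_def)
    then have "0 \<le> l2_inner m (\<lambda>x. f x - \<alpha> * w x) ?u" using \<alpha> by (simp add: zero_le_mult_iff)
    then have "(l2_norm m ?u)\<^sup>2 \<le> l2_inner m f ?u"
      using l2.diff_left[OF fL uL uL] by (simp add: l2_norm_sq)
    also have "\<dots> \<le> l2_norm m f * l2_norm m ?u" using l2_cauchy_schwarz[OF fL uL] by linarith
    finally have "l2_norm m ?u * l2_norm m ?u \<le> l2_norm m f * l2_norm m ?u"
      by (simp add: power2_eq_square)
    then have uf: "l2_norm m ?u \<le> l2_norm m f"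
      using l2_norm_nonneg[of m ?u] l2_norm_nonneg[of m f] by (cases "l2_norm m ?u = 0") auto
    have uf2: "(l2_norm m ?u)\<^sup>2 \<le> ?F\<^sup>2"
      using uf fF l2_norm_nonneg by (intro power_mono) auto
    define y where "y = sqrt (?c + ?F\<^sup>2)"
    have y2: "y\<^sup>2 = ?c + ?F\<^sup>2" and y0: "0 \<le> y" using c0 by (auto simp: y_def)
    have "(E1_norm m \<E> ?u)\<^sup>2 \<le> y\<^sup>2" unfolding E1_norm_sq[OF u] y2 using Eu uf2 by linarith
    then have uy: "E1_norm m \<E> ?u \<le> y" using y0 by (rule power2_le_imp_le)
    have "?c = form_shift m \<E> 1 ?u f - l2_inner m ?u f"
      using approx_form_eq[OF w fL f] by (simp add: form_shift_def)
    also have "\<dots> \<le> K * y * ?F + ?F\<^sup>2"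
    proof -
      have "K * E1_norm m \<E> ?u * ?F \<le> K * y * ?F"
        using uy K(1) F0 by (intro mult_right_mono mult_left_mono)
      moreover have "l2_norm m ?u * l2_norm m f \<le> ?F * ?F"
        using uf fF l2_norm_nonneg[of m] F0 by (intro mult_mono) auto
      ultimately show ?thesis
        using K(2)[OF u f] l2_cauchy_schwarz[OF uL fL] by (simp add: power2_eq_square)
    qed
    finally have "y\<^sup>2 \<le> K * y * ?F + 2 * ?F\<^sup>2" using y2 by simp
    then have "y \<le> (K + 2) * ?F" using quadratic_bound[OF K(1) F0] by blast
    then have "y\<^sup>2 \<le> ((K + 2) * ?F)\<^sup>2" using y0 by (rule power_mono)
    then show ?thesis using y2 by (smt (verit) zero_le_power2)
  qed
  then show ?thesis by blast
qed

text \<open>The functions \<open>\<alpha> G\<^sub>\<alpha> f\<close> have bounded energy and tend to \<open>f\<close> in \<open>L\<^sup>2\<close>, hence weakly in \<open>\<F>\<close>.\<close>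

lemma approx_form_tendsto:
  assumes f: "f \<in> \<F>" and g: "g \<in> \<F>" and w: "\<And>n. is_resolvent (real (Suc n)) f (w n)"
  shows "(\<lambda>n. approx_form (real (Suc n)) (w n) f g) \<longlonglongrightarrow> \<E> f g"
proof -
  obtain M where M: "\<And>\<alpha> w. \<lbrakk>\<alpha> > 0; is_resolvent \<alpha> f w\<rbrakk> \<Longrightarrow> approx_form \<alpha> w f f \<le> M"
    using approx_form_bounded[OF f] by blast
  let ?u = "\<lambda>n x. real (Suc n) * w n x"
  have fL: "f \<in> L2 m" using in_L2[OF f] .
  have u: "?u n \<in> \<F>" for n using w by (auto simp: is_resolvent_def intro: E.scale)
  let ?q = "\<lambda>n. l2_inner m (\<lambda>x. f x - ?u n x) (\<lambda>x. f x - ?u n x)"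
  have eq: "\<E> (?u n) (?u n) = approx_form (real (Suc n)) (w n) f f - real (Suc n) * ?q n" for n
    using energy_resolvent[OF w fL] .
  have q0: "0 \<le> ?q n" for n using l2.nonneg[OF l2.diff[OF fL in_L2[OF u]]] .
  have M': "approx_form (real (Suc n)) (w n) f f \<le> M" for n using M[OF _ w] by simp
  have bd: "\<E> (?u n) (?u n) \<le> M" for n
    using eq[of n] M'[of n] mult_nonneg_nonneg[OF of_nat_0_le_iff q0, of "Suc n" n] by linarith
  have le: "real (Suc n) * ?q n \<le> M" for n
    using eq[of n] M'[of n] E.nonneg[OF u, of n] by linarith
  have "?q \<longlonglongrightarrow> 0"
  proof (rule Lim_null_comparison[OF always_eventually], rule allI)
    show "norm (?q n) \<le> M * inverse (real (Suc n))" for n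
      using le[of n] q0[of n] by (simp add: field_simps del: of_nat_Suc)
    show "(\<lambda>n. M * inverse (real (Suc n))) \<longlonglongrightarrow> 0"
      using tendsto_mult[OF tendsto_const LIMSEQ_inverse_real_of_nat, of M] by simp
  qed
  then have "(\<lambda>n. sqrt (?q n)) \<longlonglongrightarrow> sqrt 0" by (rule tendsto_real_sqrt)
  then have "(\<lambda>n. l2_norm m (\<lambda>x. ?u n x - f x)) \<longlonglongrightarrow> 0"
    using l2.diff_swap[OF in_L2[OF u] fL] by (simp add: l2_norm_def)
  from weak_tendsto[OF u f g bd this] show ?thesis
    using approx_form_eq[OF w fL g] by simp
qed

end

section \<open>Lattice and algebra operations on a Dirichlet space\<close>

text \<open>Riemann sums for \<open>t\<^sup>2 = \<integral>\<^sub>0\<^sup>\<infinity> 2 (t - s)\<^sup>+ ds\<close>. Replacing \<open>t\<close> by \<open>t - h\<close> removes the first summand and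
  changes the error by \<open>h\<^sup>2\<close>, which gives an error of at most \<open>h t\<close>.\<close>

lemma Riemann_sum_square:
  fixes h t :: real
  assumes "0 \<le> h" "0 \<le> t" "t \<le> real n * h"
  shows "0 \<le> t\<^sup>2 - (\<Sum>i<n. 2 * h * max (t - real (Suc i) * h) 0)
    \<and> t\<^sup>2 - (\<Sum>i<n. 2 * h * max (t - real (Suc i) * h) 0) \<le> h * t"
  using assms(2,3)
proof (induction n arbitrary: t)
  case 0
  then show ?case by simp
next
  case (Suc n)
  have split: "(\<Sum>i<Suc n. 2 * h * max (t - real (Suc i) * h) 0)
      = 2 * h * max (t - h) 0 + (\<Sum>i<n. 2 * h * max ((t - h) - real (Suc i) * h) 0)"
    unfolding sum.lessThan_Suc_shift by (simp add: algebra_simps)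
  show ?case
  proof (cases "h \<le> t")
    case True
    have "t - h \<le> real n * h" using Suc.prems(2) by (simp add: algebra_simps)
    note IH = Suc.IH[OF _ this]
    have max: "max (t - h) 0 = t - h" using True by simp
    have "0 \<le> h\<^sup>2" by simp
    moreover have "t\<^sup>2 = (t - h)\<^sup>2 + 2 * h * (t - h) + h\<^sup>2" by (simp add: power2_eq_square algebra_simps)
    moreover have "h * (t - h) + h\<^sup>2 = h * t" by (simp add: power2_eq_square algebra_simps)
    ultimately show ?thesis
      unfolding split max using IH True by (intro conjI) linarith+
  next
    case False
    have "max ((t - h) - real (Suc i) * h) 0 = 0" for i
      using False assms(1) mult_nonneg_nonneg[of "real (Suc i)" h] by (intro max_absorb2) linarith
    then have "(\<Sum>i<Suc n. 2 * h * max (t - real (Suc i) * h) 0) = 0"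
      unfolding split using False by simp
    moreover have "t * t \<le> h * t" using False Suc.prems(1) by (intro mult_right_mono) auto
    ultimately show ?thesis by (simp add: power2_eq_square)
  qed
qed

context dirichlet_form
begin

lemma is_closed_form: "closed_form m \<E> \<F>"
  by (unfold_locales; fact dom_L2 dom_AE dom_zero dom_add dom_scale form_AE form_add_left
      form_add_right form_scale_left form_scale_right form_nonneg form_closed sector)

end

sublocale dirichlet_form \<subseteq> closed_form
  by (rule is_closed_form)

context dirichlet_form
begin

text \<open>The sum of the two Markov inequalities; its cross terms cancel.\<close>

lemma unit_contraction_energy:
  assumes "u \<in> \<F>"
  shows "\<E> (unit_contraction u) (unit_contraction u) \<le> \<E> u u"
  using markov1[OF assms] markov2[OF assms] markov_dom[OF assms] assms
  by (simp add: E.bilinear)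

lemma truncation:
  assumes u: "u \<in> \<F>" and s: "0 < s"
  shows "(\<lambda>x. min (max (u x) 0) s) \<in> \<F>"
    and "\<E> (\<lambda>x. min (max (u x) 0) s) (\<lambda>x. min (max (u x) 0) s) \<le> \<E> u u"
proof -
  let ?v = "\<lambda>x. (1 / s) * u x"
  have v: "?v \<in> \<F>" using u by (rule E.scale)
  have eq: "(\<lambda>x. min (max (u x) 0) s) = (\<lambda>x. s * unit_contraction ?v x)"
    using s by (auto simp: unit_contraction_def min_def max_def field_simps)
  show "(\<lambda>x. min (max (u x) 0) s) \<in> \<F>"
    unfolding eq using markov_dom[OF v] by (rule E.scale)
  have "s\<^sup>2 * \<E> (unit_contraction ?v) (unit_contraction ?v) \<le> s\<^sup>2 * \<E> ?v ?v"
    using unit_contraction_energy[OF v] by (rule mult_left_mono) simp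
  also have "\<E> ?v ?v = (1 / s) * ((1 / s) * \<E> u u)"
    using u v by (simp only: E.scale_left E.scale_right)
  finally show "\<E> (\<lambda>x. min (max (u x) 0) s) (\<lambda>x. min (max (u x) 0) s) \<le> \<E> u u"
    unfolding eq using s markov_dom[OF v] E.scale[OF markov_dom[OF v], of s]
    by (simp add: E.scale_left E.scale_right power2_eq_square)
qed

text \<open>The truncations of \<open>u\<close> to \<open>[0, n]\<close> have no more energy than \<open>u\<close> and tend to \<open>u\<^sup>+\<close> in \<open>L\<^sup>2\<close>.\<close>

lemma positive_part:
  assumes u: "u \<in> \<F>"
  shows "(\<lambda>x. max (u x) 0) \<in> \<F>" "\<E> (\<lambda>x. max (u x) 0) (\<lambda>x. max (u x) 0) \<le> \<E> u u"
proof -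
  let ?p = "\<lambda>x. max (u x) 0"
  have uL: "u \<in> L2 m" using in_L2[OF u] .
  have pL: "?p \<in> L2 m"
    using L2_measurable[OF uL] by (intro L2_dominated[OF uL, of _ 1]) auto
  have "?p \<in> \<F> \<and> \<E> ?p ?p \<le> \<E> u u"
  proof (rule bounded_energy_L2_limit[OF pL])
    fix \<epsilon> :: real assume "\<epsilon> > 0"
    then have "\<forall>\<^sub>F n in sequentially. l2_norm m (\<lambda>x. ?p x - min (?p x) (real n)) < \<epsilon> \<and> n > 0"
      using order_tendstoD(2)[OF truncation_tendsto_L2[OF uL]] eventually_gt_at_top[of 0]
      by (intro eventually_conj)
    then obtain n :: nat where "l2_norm m (\<lambda>x. ?p x - min (?p x) (real n)) < \<epsilon>" "n > 0"
      by (auto simp: eventually_sequentially)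
    then show "\<exists>w\<in>\<F>. l2_norm m (\<lambda>x. ?p x - w x) < \<epsilon> \<and> \<E> w w \<le> \<E> u u"
      using truncation[OF u, of "real n"] by (intro bexI[of _ "\<lambda>x. min (?p x) (real n)"]) auto
  qed
  then show "?p \<in> \<F>" "\<E> ?p ?p \<le> \<E> u u" by auto
qed

lemma minimum:
  assumes "u \<in> \<F>" "v \<in> \<F>"
  shows "(\<lambda>x. min (u x) (v x)) \<in> \<F>"
    and "E.nrm (\<lambda>x. min (u x) (v x)) \<le> E.nrm u + (E.nrm u + E.nrm v)"
proof -
  let ?d = "\<lambda>x. u x - v x"
  have d: "?d \<in> \<F>" using assms by (rule E.diff)
  note p = positive_part[OF d]
  have eq: "(\<lambda>x. min (u x) (v x)) = (\<lambda>x. u x - max (?d x) 0)" by auto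
  show "(\<lambda>x. min (u x) (v x)) \<in> \<F>" unfolding eq using assms(1) p(1) by (rule E.diff)
  have "E.nrm (\<lambda>x. u x - max (?d x) 0) \<le> E.nrm u + E.nrm (\<lambda>x. max (?d x) 0)"
    using assms(1) p(1) by (rule E.triangle_diff)
  also have "E.nrm (\<lambda>x. max (?d x) 0) \<le> E.nrm ?d" using p(2) by simp
  also have "E.nrm ?d \<le> E.nrm u + E.nrm v" using assms by (rule E.triangle_diff)
  finally show "E.nrm (\<lambda>x. min (u x) (v x)) \<le> E.nrm u + (E.nrm u + E.nrm v)" unfolding eq by simp
qed

text \<open>The square is an average of the functions \<open>2 (f - s)\<^sup>+\<close> with \<open>0 < s < M\<close>, and each \<open>(f - s)\<^sup>+\<close> is the difference
  of \<open>f\<^sup>+\<close> and the truncation of \<open>f\<close> at \<open>s\<close>, so its energy norm is at most twice that of \<open>f\<close>. The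
  triangle inequality bounds the energy norm of the Riemann sums, uniformly in the mesh.\<close>

lemma square_bounded_nonneg:
  assumes f: "f \<in> \<F>" and nonneg: "AE x in m. 0 \<le> f x" and bd: "AE x in m. f x \<le> C"
  shows "(\<lambda>x. (f x)\<^sup>2) \<in> \<F>"
proof -
  \<comment> \<open>a positive bound, so that the mesh \<open>M / n\<close> below is positive\<close>
  define M where "M = max C 1"
  have M: "M > 0" and bdM: "AE x in m. f x \<le> M" using bd by (auto simp: M_def)
  have fL: "f \<in> L2 m" using in_L2[OF f] .
  have sqL: "(\<lambda>x. (f x)\<^sup>2) \<in> L2 m"
  proof (rule L2_dominated[OF fL])
    show "AE x in m. \<bar>(f x)\<^sup>2\<bar> \<le> M * \<bar>f x\<bar>"
      using nonneg bdM by eventually_elim (auto simp: power2_eq_square intro: mult_right_mono)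
  qed (use L2_measurable[OF fL] in auto)
  have "(\<lambda>x. (f x)\<^sup>2) \<in> \<F> \<and> \<E> (\<lambda>x. (f x)\<^sup>2) (\<lambda>x. (f x)\<^sup>2) \<le> (4 * M * E.nrm f)\<^sup>2"
  proof (rule bounded_energy_L2_limit[OF sqL])
    fix \<epsilon> :: real assume "\<epsilon> > 0"
    obtain n :: nat where n: "M * l2_norm m f / \<epsilon> < real n" using reals_Archimedean2 by blast
    define h where "h = M / real n"
    have n0: "n > 0"
    proof -
      have "0 \<le> M * l2_norm m f / \<epsilon>" using M l2_norm_nonneg[of m f] \<open>\<epsilon> > 0\<close> by simp
      then have "0 < real n" using n by linarith
      then show ?thesis by simp
    qed
    have h: "h > 0" "real n * h = M" using M n0 by (auto simp: h_def)
    define r where "r i = (\<lambda>x. 2 * h * max (f x - real (Suc i) * h) 0)" for i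
    define R where "R = (\<lambda>x. \<Sum>i<n. r i x)"
    have r: "r i \<in> \<F>" "E.nrm (r i) \<le> 2 * h * (2 * E.nrm f)" for i
    proof -
      have s: "0 < real (Suc i) * h" using h by simp
      let ?p = "\<lambda>x. max (f x) 0" and ?t = "\<lambda>x. min (max (f x) 0) (real (Suc i) * h)"
      note p = positive_part[OF f] and t = truncation[OF f s]
      have eq: "r i = (\<lambda>x. 2 * h * (?p x - ?t x))"
        unfolding r_def using s by (intro ext arg_cong[where f = "(*) (2 * h)"]) auto
      show "r i \<in> \<F>" unfolding eq by (intro E.scale E.diff p t)
      have "E.nrm (\<lambda>x. ?p x - ?t x) \<le> E.nrm ?p + E.nrm ?t" using p(1) t(1) by (rule E.triangle_diff)
      also have "\<dots> \<le> E.nrm f + E.nrm f" using p(2) t(2) by (intro add_mono) auto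
      finally have "2 * h * E.nrm (\<lambda>x. ?p x - ?t x) \<le> 2 * h * (2 * E.nrm f)"
        using h by (intro mult_left_mono) auto
      then show "E.nrm (r i) \<le> 2 * h * (2 * E.nrm f)"
        unfolding eq E.nrm_scale[OF E.diff[OF p(1) t(1)]] using h by simp
    qed
    have R: "R \<in> \<F>" "E.nrm R \<le> (\<Sum>i<n. E.nrm (r i))"
      using E.nrm_sum[of n r] r(1) by (auto simp: R_def)
    note R(2)
    also have "(\<Sum>i<n. E.nrm (r i)) \<le> (\<Sum>i<n. 2 * h * (2 * E.nrm f))" by (intro sum_mono r)
    also have "\<dots> = 4 * (real n * h) * E.nrm f" by simp
    finally have "E.nrm R \<le> 4 * M * E.nrm f" unfolding h(2) .
    then have "(E.nrm R)\<^sup>2 \<le> (4 * M * E.nrm f)\<^sup>2" using E.nrm_nonneg[OF R(1)] by (rule power_mono)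
    then have energy: "\<E> R R \<le> (4 * M * E.nrm f)\<^sup>2" unfolding E.nrm_sq[OF R(1)] .
    have "AE x in m. \<bar>(f x)\<^sup>2 - R x\<bar> \<le> h * \<bar>f x\<bar>"
      using nonneg bdM
    proof eventually_elim
      case (elim x)
      then show ?case using Riemann_sum_square[of h "f x" n] h by (simp add: R_def r_def)
    qed
    then have "l2_inner m (\<lambda>x. (f x)\<^sup>2 - R x) (\<lambda>x. (f x)\<^sup>2 - R x) \<le> h\<^sup>2 * l2_inner m f f"
      using L2_measurable[OF sqL] in_measurable[OF R(1)] by (intro l2_inner_sq_mono[OF fL]) auto
    then have "l2_norm m (\<lambda>x. (f x)\<^sup>2 - R x) \<le> sqrt (h\<^sup>2 * l2_inner m f f)"
      unfolding l2_norm_def by simp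
    also have "\<dots> = h * l2_norm m f" using h by (simp add: l2_norm_def real_sqrt_mult)
    also have "\<dots> < \<epsilon>" using n n0 \<open>\<epsilon> > 0\<close> by (simp add: h_def field_simps)
    finally show "\<exists>w\<in>\<F>. l2_norm m (\<lambda>x. (f x)\<^sup>2 - w x) < \<epsilon> \<and> \<E> w w \<le> (4 * M * E.nrm f)\<^sup>2"
      by (intro bexI[OF _ R(1)] conjI energy)
  qed
  then show ?thesis by simp
qed

text \<open>By polarisation.\<close>

lemma product_bounded_nonneg:
  assumes f: "f \<in> \<F>" "AE x in m. 0 \<le> f x" "AE x in m. f x \<le> C"
    and g: "g \<in> \<F>" "AE x in m. 0 \<le> g x" "AE x in m. g x \<le> D"
  shows "(\<lambda>x. f x * g x) \<in> \<F>"
proof -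
  have s: "(\<lambda>x. (f x + g x)\<^sup>2) \<in> \<F>"
  proof (rule square_bounded_nonneg[of _ "C + D"])
    show "(\<lambda>x. f x + g x) \<in> \<F>" using f(1) g(1) by (rule E.add)
    show "AE x in m. 0 \<le> f x + g x" "AE x in m. f x + g x \<le> C + D" using f g by auto
  qed
  have "(\<lambda>x. (1 / 2) * (((f x + g x)\<^sup>2 - (f x)\<^sup>2) - (g x)\<^sup>2)) \<in> \<F>"
    by (intro E.scale E.diff s square_bounded_nonneg[OF f] square_bounded_nonneg[OF g])
  then show ?thesis by (simp add: power2_sum)
qed

end

text \<open>For \<open>0 \<le> f\<close> in \<open>I\<close> and \<open>0 \<le> g \<le> D\<close> the product lies between zero and \<open>D f\<close>, an element of \<open>I\<close>. The general
  case splits both factors into positive and negative parts.\<close>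

lemma algebraic_ideal_if_order_ideal:
  assumes big: "dirichlet_form m \<E> \<F>" and small: "dirichlet_form m \<D> I" and sub: "I \<subseteq> \<F>"
    and ideal: "\<And>u v. \<lbrakk>u \<in> I; v \<in> \<F>; AE x in m. 0 \<le> v x; AE x in m. v x \<le> u x\<rbrakk> \<Longrightarrow> v \<in> I"
  shows "algebraic_ideal (bounded_part m I) (bounded_part m \<F>)"
proof -
  interpret big: dirichlet_form m \<E> \<F> by (rule big)
  interpret small: dirichlet_form m \<D> I by (rule small)
  have nonneg: "(\<lambda>x. f x * g x) \<in> I"
    if f: "f \<in> I" "AE x in m. 0 \<le> f x" "AE x in m. f x \<le> C"
      and g: "g \<in> \<F>" "AE x in m. 0 \<le> g x" "AE x in m. g x \<le> D" for f g C D
  proof (rule ideal)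
    show "(\<lambda>x. D * f x) \<in> I" using f(1) by (rule small.E.scale)
    show "(\<lambda>x. f x * g x) \<in> \<F>" using f g sub by (intro big.product_bounded_nonneg) auto
    show "AE x in m. 0 \<le> f x * g x" using f(2) g(2) by eventually_elim simp
    show "AE x in m. f x * g x \<le> D * f x"
      using f(2) g(3) by eventually_elim (simp add: mult.commute[of D] mult_left_mono)
  qed
  have prod: "(\<lambda>x. f x * g x) \<in> I"
    if f: "f \<in> I" "AE x in m. \<bar>f x\<bar> \<le> C" and g: "g \<in> \<F>" "AE x in m. \<bar>g x\<bar> \<le> D" for f g C D
  proof -
    let ?p = "\<lambda>u (x::'a). max (u x) (0::real)" and ?n = "\<lambda>u (x::'a). max (- 1 * u x) (0::real)"
    have pn: "?p f \<in> I" "?n f \<in> I" "?p g \<in> \<F>" "?n g \<in> \<F>"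
      using small.positive_part(1)[OF f(1)] small.positive_part(1)[OF small.E.scale[OF f(1)]]
        big.positive_part(1)[OF g(1)] big.positive_part(1)[OF big.E.scale[OF g(1)]] .
    have ae: "AE x in m. 0 \<le> ?p u x" "AE x in m. 0 \<le> ?n u x" for u by auto
    have bf: "AE x in m. ?p f x \<le> C" "AE x in m. ?n f x \<le> C" using f(2) by auto
    have bg: "AE x in m. ?p g x \<le> D" "AE x in m. ?n g x \<le> D" using g(2) by auto
    have "(\<lambda>x. (?p f x * ?p g x - ?p f x * ?n g x) - (?n f x * ?p g x - ?n f x * ?n g x)) \<in> I"
      by (intro small.E.diff; rule nonneg[OF pn(1) ae(1) bf(1) pn(3) ae(1) bg(1)]
          nonneg[OF pn(1) ae(1) bf(1) pn(4) ae(2) bg(2)] nonneg[OF pn(2) ae(2) bf(2) pn(3) ae(1) bg(1)]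
          nonneg[OF pn(2) ae(2) bf(2) pn(4) ae(2) bg(2)])
    moreover have "(?p f x * ?p g x - ?p f x * ?n g x) - (?n f x * ?p g x - ?n f x * ?n g x) = f x * g x" for x
      by (auto simp: max_def algebra_simps)
    ultimately show ?thesis by simp
  qed
  show ?thesis
    unfolding algebraic_ideal_def
  proof (intro conjI ballI)
    show "bounded_part m I \<subseteq> bounded_part m \<F>" using sub by (auto simp: bounded_part_def)
    fix f g assume "f \<in> bounded_part m I" "g \<in> bounded_part m \<F>"
    then obtain C D where f: "f \<in> I" "AE x in m. \<bar>f x\<bar> \<le> C" and g: "g \<in> \<F>" "AE x in m. \<bar>g x\<bar> \<le> D"
      by (auto simp: bounded_part_def)
    have "AE x in m. \<bar>f x * g x\<bar> \<le> C * D"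
      using f(2) g(2) by eventually_elim (auto simp: abs_mult intro!: mult_mono)
    then show "(\<lambda>x. f x * g x) \<in> bounded_part m I"
      using prod[OF f g] by (auto simp: bounded_part_def)
  qed
qed

section \<open>Closures of subspaces of the form domain\<close>

context closed_form
begin

lemma subset_closure:
  assumes "D \<subseteq> \<F>"
  shows "D \<subseteq> E1_closure m \<E> \<F> D"
proof
  fix f assume f: "f \<in> D"
  have "E1_norm m \<E> (\<lambda>x. f x - f x) = 0"
    using E1.nrm_scale[OF E1.zero, of 0] by (simp add: E1_norm_def)
  then have "\<exists>g\<in>D. E1_norm m \<E> (\<lambda>x. f x - g x) < \<epsilon>" if "\<epsilon> > 0" for \<epsilon>
    using f that by (intro bexI[of _ f]) auto
  then show "f \<in> E1_closure m \<E> \<F> D" using f assms by (auto simp: E1_closure_def)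
qed

lemma closure_sequence:
  assumes "D \<subseteq> \<F>" "f \<in> E1_closure m \<E> \<F> D"
  obtains w where "\<And>n::nat. w n \<in> D" "(\<lambda>n. E1_norm m \<E> (\<lambda>x. w n x - f x)) \<longlonglongrightarrow> 0"
proof -
  have fF: "f \<in> \<F>" using assms(2) by (simp add: E1_closure_def)
  have "\<exists>g\<in>D. E1_norm m \<E> (\<lambda>x. f x - g x) < inverse (real (Suc n))" for n
    using assms(2) by (simp add: E1_closure_def del: of_nat_Suc)
  then obtain w where w: "\<And>n. w n \<in> D" "\<And>n. E1_norm m \<E> (\<lambda>x. f x - w n x) < inverse (real (Suc n))"
    by metis
  have "(\<lambda>n. E1_norm m \<E> (\<lambda>x. w n x - f x)) \<longlonglongrightarrow> 0"
  proof (rule Lim_null_comparison[OF always_eventually LIMSEQ_inverse_real_of_nat], rule allI)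
    fix n
    have wF: "w n \<in> \<F>" using w(1) assms(1) by blast
    show "norm (E1_norm m \<E> (\<lambda>x. w n x - f x)) \<le> inverse (real (Suc n))"
      using w(2)[of n] E1_norm_nonneg[OF E.diff[OF wF fF]] E1.diff_swap[OF fF wF]
      by (simp add: E1_norm_def del: of_nat_Suc)
  qed
  with w(1) that show ?thesis by blast
qed

text \<open>A closed subspace of a coercive closed form is again one; the Fatou lemma then applies to
  it, so that weak limits of its elements stay in it.\<close>

lemma closure_closed_form:
  assumes D: "D \<subseteq> \<F>" "(\<lambda>x. 0) \<in> D"
    and D_add: "\<And>f g. \<lbrakk>f \<in> D; g \<in> D\<rbrakk> \<Longrightarrow> (\<lambda>x. f x + g x) \<in> D"
    and D_scale: "\<And>f c. f \<in> D \<Longrightarrow> (\<lambda>x. c * f x) \<in> D"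
  shows "closed_form m \<E> (E1_closure m \<E> \<F> D)"
proof -
  let ?C = "E1_closure m \<E> \<F> D"
  have sub: "?C \<subseteq> \<F>" by (auto simp: E1_closure_def)
  then have CF: "f \<in> \<F>" if "f \<in> ?C" for f using that by blast
  have DF: "f \<in> \<F>" if "f \<in> D" for f using that D by blast
  have approx: "\<exists>g\<in>D. E1.nrm (\<lambda>x. f x - g x) < \<epsilon>" if "f \<in> ?C" "\<epsilon> > 0" for f \<epsilon>
    using that by (simp add: E1_closure_def E1_norm_def)
  have intro: "f \<in> ?C" if "f \<in> \<F>" "\<And>\<epsilon>. \<epsilon> > 0 \<Longrightarrow> \<exists>g\<in>D. E1.nrm (\<lambda>x. f x - g x) < \<epsilon>" for f
    using that by (simp add: E1_closure_def E1_norm_def)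
  show ?thesis
  proof
    show "?C \<subseteq> L2 m" using sub dom_L2 by blast
    show "g \<in> ?C" if f: "f \<in> ?C" and g: "g \<in> borel_measurable m" "AE x in m. f x = g x" for f g
    proof (rule intro)
      show gF: "g \<in> \<F>" using dom_AE[OF CF[OF f] g] .
      fix \<epsilon> :: real assume "\<epsilon> > 0"
      then obtain h where h: "h \<in> D" "E1_norm m \<E> (\<lambda>x. f x - h x) < \<epsilon>"
        using approx[OF f] by (auto simp: E1_norm_def)
      have "E1_norm m \<E> (\<lambda>x. f x - h x) = E1_norm m \<E> (\<lambda>x. g x - h x)"
        using g(2) by (intro E1_norm_AE E.diff CF[OF f] gF DF[OF h(1)]) auto
      then show "\<exists>h\<in>D. E1.nrm (\<lambda>x. g x - h x) < \<epsilon>" using h by (auto simp: E1_norm_def)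
    qed
    show "(\<lambda>x. 0) \<in> ?C" using D subset_closure by blast
    show "(\<lambda>x. f x + g x) \<in> ?C" if f: "f \<in> ?C" and g: "g \<in> ?C" for f g
    proof (rule intro)
      show "(\<lambda>x. f x + g x) \<in> \<F>" using CF[OF f] CF[OF g] by (rule E.add)
      fix \<epsilon> :: real assume "\<epsilon> > 0"
      then obtain a b where a: "a \<in> D" "E1.nrm (\<lambda>x. f x - a x) < \<epsilon> / 2"
        and b: "b \<in> D" "E1.nrm (\<lambda>x. g x - b x) < \<epsilon> / 2"
        using approx[OF f, of "\<epsilon>/2"] approx[OF g, of "\<epsilon>/2"] by auto
      have eq: "(\<lambda>x. f x + g x - (a x + b x)) = (\<lambda>x. (f x - a x) + (g x - b x))" by auto
      have "E1.nrm (\<lambda>x. f x + g x - (a x + b x)) < \<epsilon>"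
        unfolding eq
        using E1.triangle[OF E.diff[OF CF[OF f] DF[OF a(1)]] E.diff[OF CF[OF g] DF[OF b(1)]]] a(2) b(2)
        by linarith
      then show "\<exists>h\<in>D. E1.nrm (\<lambda>x. f x + g x - h x) < \<epsilon>"
        using D_add[OF a(1) b(1)] by (intro bexI[of _ "\<lambda>x. a x + b x"])
    qed
    show "(\<lambda>x. c * f x) \<in> ?C" if f: "f \<in> ?C" for f c
    proof (rule intro)
      show "(\<lambda>x. c * f x) \<in> \<F>" using CF[OF f] by (rule E.scale)
      fix \<epsilon> :: real assume "\<epsilon> > 0"
      then have "\<epsilon> / (\<bar>c\<bar> + 1) > 0" by simp
      then obtain a where a: "a \<in> D" "E1.nrm (\<lambda>x. f x - a x) < \<epsilon> / (\<bar>c\<bar> + 1)"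
        using approx[OF f] by blast
      have d: "(\<lambda>x. f x - a x) \<in> \<F>" using E.diff[OF CF[OF f] DF[OF a(1)]] .
      have eq: "(\<lambda>x. c * f x - c * a x) = (\<lambda>x. c * (f x - a x))" by (auto simp: algebra_simps)
      have "\<bar>c\<bar> * E1.nrm (\<lambda>x. f x - a x) \<le> (\<bar>c\<bar> + 1) * E1.nrm (\<lambda>x. f x - a x)"
        using E1.nrm_nonneg[OF d] by (intro mult_right_mono) auto
      also have "\<dots> < \<epsilon>" using a(2) by (simp add: field_simps)
      finally have "E1.nrm (\<lambda>x. c * f x - c * a x) < \<epsilon>"
        unfolding eq E1.nrm_scale[OF d] .
      then show "\<exists>h\<in>D. E1.nrm (\<lambda>x. c * f x - h x) < \<epsilon>"
        using D_scale[OF a(1), of c] by (intro bexI[of _ "\<lambda>x. c * a x"])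
    qed
    show "\<exists>f\<in>?C. (\<lambda>n::nat. E1_norm m \<E> (\<lambda>x. w n x - f x)) \<longlonglongrightarrow> 0"
      if w: "\<And>n. w n \<in> ?C"
        and Cauchy: "\<forall>\<epsilon>>0. \<exists>N. \<forall>i\<ge>N. \<forall>j\<ge>N. E1_norm m \<E> (\<lambda>x. w i x - w j x) < \<epsilon>" for w
    proof -
      obtain f where f: "f \<in> \<F>" and lim: "(\<lambda>n. E1_norm m \<E> (\<lambda>x. w n x - f x)) \<longlonglongrightarrow> 0"
        using form_closed[OF CF[OF w] Cauchy] by blast
      have "f \<in> ?C"
      proof (rule intro[OF f])
        fix \<epsilon> :: real assume "\<epsilon> > 0"
        then have "\<forall>\<^sub>F n in sequentially. E1_norm m \<E> (\<lambda>x. w n x - f x) < \<epsilon> / 2"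
          using order_tendstoD(2)[OF lim, of "\<epsilon>/2"] by simp
        then obtain n where n: "E1.nrm (\<lambda>x. w n x - f x) < \<epsilon> / 2"
          by (auto simp: eventually_sequentially E1_norm_def)
        obtain a where a: "a \<in> D" "E1.nrm (\<lambda>x. w n x - a x) < \<epsilon> / 2"
          using approx[OF w, of "\<epsilon>/2" n] \<open>\<epsilon> > 0\<close> by auto
        have "E1.nrm (\<lambda>x. f x - a x) < \<epsilon>"
          using E1.triangle_via[OF f CF[OF w[of n]] DF[OF a(1)]] n a(2) E1.diff_swap[OF f CF[OF w[of n]]]
          by simp
        then show "\<exists>g\<in>D. E1.nrm (\<lambda>x. f x - g x) < \<epsilon>" using a(1) by blast
      qed
      with lim show ?thesis by blast
    qed
    show "\<exists>K. \<forall>u\<in>?C. \<forall>v\<in>?C. \<bar>form_shift m \<E> 1 u v\<bar> \<le> K * E1_norm m \<E> u * E1_norm m \<E> v"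
      using sector CF by blast
    show "\<E> f g = \<E> f' g'" if "f \<in> ?C" "f' \<in> ?C" "g \<in> ?C" "g' \<in> ?C"
        "AE x in m. f x = f' x" "AE x in m. g x = g' x" for f f' g g'
      using form_AE[OF CF CF CF CF] that by blast
  qed (use CF in \<open>simp_all add: E.bilinear E.nonneg\<close>)
qed

end

text \<open>Contractions of approximating functions are bounded in energy and converge in \<open>L\<^sup>2\<close>, so by
  the Fatou lemma the closure inherits the Markovian property from the smaller domain.\<close>

lemma dirichlet_form_closure:
  assumes big: "dirichlet_form m \<E> \<F>" and small: "dirichlet_form m \<E>' \<F>'" and sub: "\<F>' \<subseteq> \<F>"
  shows "dirichlet_form m \<E> (E1_closure m \<E> \<F> \<F>')"
proof -
  interpret big: dirichlet_form m \<E> \<F> by (rule big)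
  interpret small: dirichlet_form m \<E>' \<F>' by (rule small)
  let ?C = "E1_closure m \<E> \<F> \<F>'"
  have cf: "closed_form m \<E> ?C"
    by (rule big.closure_closed_form[OF sub small.E.zero small.E.add small.E.scale])
  interpret C: closed_form m \<E> ?C by (rule cf)
  have sub1: "\<F>' \<subseteq> ?C" by (rule big.subset_closure[OF sub])
  have CF: "f \<in> \<F>" if "f \<in> ?C" for f using that by (simp add: E1_closure_def)
  have markov: "unit_contraction u \<in> ?C" if u: "u \<in> ?C" for u
  proof -
    have uF: "u \<in> \<F>" and uL: "u \<in> L2 m" using CF[OF u] big.in_L2 by auto
    have cL: "unit_contraction u \<in> L2 m" using big.markov_dom[OF uF] big.in_L2 by blast
    have "unit_contraction u \<in> ?C \<and> \<E> (unit_contraction u) (unit_contraction u)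
        \<le> (E1_norm m \<E> u + 1)\<^sup>2"
    proof (rule C.bounded_energy_L2_limit[OF cL])
      fix \<epsilon> :: real assume "\<epsilon> > 0"
      then have "min \<epsilon> 1 > 0" by simp
      then obtain w where w: "w \<in> \<F>'" "E1_norm m \<E> (\<lambda>x. u x - w x) < min \<epsilon> 1"
        using u unfolding E1_closure_def by blast
      have wF: "w \<in> \<F>" and wL: "w \<in> L2 m" using w(1) sub big.in_L2 by auto
      have cw: "unit_contraction w \<in> ?C" using small.markov_dom[OF w(1)] sub1 by blast
      have "l2_norm m (\<lambda>x. unit_contraction u x - unit_contraction w x) \<le> l2_norm m (\<lambda>x. u x - w x)"
        using L2_measurable[OF cL] C.in_measurable[OF cw]
        by (intro l2_norm_mono l2.diff uL wL) (auto simp: unit_contraction_def)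
      also have "\<dots> < \<epsilon>" using big.l2_norm_le_E1_norm[OF big.E.diff[OF uF wF]] w(2) by simp
      finally have 1: "l2_norm m (\<lambda>x. unit_contraction u x - unit_contraction w x) < \<epsilon>" .
      have "E1_norm m \<E> w \<le> E1_norm m \<E> u + 1"
        using big.E1.nrm_le_approx[OF uF wF] w(2) unfolding E1_norm_def by linarith
      then have "(E1_norm m \<E> w)\<^sup>2 \<le> (E1_norm m \<E> u + 1)\<^sup>2"
        using big.E1_norm_nonneg[OF wF] by (rule power_mono)
      then have "\<E> (unit_contraction w) (unit_contraction w) \<le> (E1_norm m \<E> u + 1)\<^sup>2"
        using big.unit_contraction_energy[OF wF] big.energy_le_E1_norm[OF wF] by linarith
      with 1 show "\<exists>v\<in>?C. l2_norm m (\<lambda>x. unit_contraction u x - v x) < \<epsilon>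
          \<and> \<E> v v \<le> (E1_norm m \<E> u + 1)\<^sup>2"
        by (intro bexI[OF _ cw] conjI)
    qed
    then show ?thesis by simp
  qed
  have dense: "\<exists>g\<in>?C. l2_norm m (\<lambda>x. f x - g x) < \<epsilon>" if "f \<in> L2 m" "\<epsilon> > 0" for f \<epsilon>
    using small.dom_dense[OF that] sub1 by blast
  show ?thesis
    by (unfold_locales; (fact C.dom_L2 C.dom_AE C.E.zero C.E.add C.E.scale C.form_AE C.E.add_left
      C.E.add_right C.E.scale_left C.E.scale_right C.E.nonneg C.form_closed C.sector markov dense |
      (rule big.markov1 big.markov2, erule CF)))
qed

text \<open>If \<open>w\<close> in the smaller domain is close to \<open>u\<close>, then \<open>v \<and> w\<^sup>+\<close> is in that domain, is at least as close to
  \<open>v \<and> u\<^sup>+ = v\<close> in \<open>L\<^sup>2\<close>, and has an energy that does not depend on how close \<open>w\<close> is.\<close>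

lemma order_ideal_closure:
  assumes big: "dirichlet_form m \<E> \<F>" and small: "dirichlet_form m \<E>' \<F>'" and sub: "\<F>' \<subseteq> \<F>"
    and ideal: "\<And>u v. \<lbrakk>u \<in> \<F>'; v \<in> \<F>; AE x in m. 0 \<le> v x; AE x in m. v x \<le> u x\<rbrakk> \<Longrightarrow> v \<in> \<F>'"
    and u: "u \<in> E1_closure m \<E> \<F> \<F>'" and v: "v \<in> \<F>" "AE x in m. 0 \<le> v x" "AE x in m. v x \<le> u x"
  shows "v \<in> E1_closure m \<E> \<F> \<F>'"
proof -
  interpret big: dirichlet_form m \<E> \<F> by (rule big)
  interpret small: dirichlet_form m \<E>' \<F>' by (rule small)
  let ?C = "E1_closure m \<E> \<F> \<F>'"
  interpret C: dirichlet_form m \<E> ?C by (rule dirichlet_form_closure[OF big small sub])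
  have sub1: "\<F>' \<subseteq> ?C" by (rule big.subset_closure[OF sub])
  have uF: "u \<in> \<F>" using u by (simp add: E1_closure_def)
  have uL: "u \<in> L2 m" and vL: "v \<in> L2 m" using uF v(1) big.in_L2 by auto
  have vm: "v \<in> borel_measurable m" using L2_measurable[OF vL] .
  let ?M = "(2 * big.E.nrm v + (E1_norm m \<E> u + 1))\<^sup>2"
  have "v \<in> ?C \<and> \<E> v v \<le> ?M"
  proof (rule C.bounded_energy_L2_limit[OF vL])
    fix \<epsilon> :: real assume "\<epsilon> > 0"
    then have "min \<epsilon> 1 > 0" by simp
    then obtain w where w: "w \<in> \<F>'" "E1_norm m \<E> (\<lambda>x. u x - w x) < min \<epsilon> 1"
      using u unfolding E1_closure_def by blast
    have wF: "w \<in> \<F>" and wL: "w \<in> L2 m" using w(1) sub big.in_L2 by auto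
    let ?w = "\<lambda>x. max (w x) 0" and ?z = "\<lambda>x. min (v x) (max (w x) 0)"
    note p = big.positive_part[OF wF]
    note z = big.minimum[OF v(1) p(1)]
    have z': "?z \<in> \<F>'"
      by (rule ideal[OF small.positive_part(1)[OF w(1)] z(1)]) (use v(2) in auto)
    have "l2_norm m (\<lambda>x. v x - ?z x) \<le> l2_norm m (\<lambda>x. u x - w x)"
    proof (rule l2_norm_mono[OF l2.diff[OF uL wL]])
      show "(\<lambda>x. v x - ?z x) \<in> borel_measurable m"
        using vm L2_measurable[OF wL] by measurable
      show "AE x in m. \<bar>v x - ?z x\<bar> \<le> \<bar>u x - w x\<bar>"
        using v(2,3) by eventually_elim auto
    qed
    also have "\<dots> < \<epsilon>" using big.l2_norm_le_E1_norm[OF big.E.diff[OF uF wF]] w(2) by simp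
    finally have 1: "l2_norm m (\<lambda>x. v x - ?z x) < \<epsilon>" .
    have "big.E.nrm ?w \<le> big.E.nrm w" using p(2) by simp
    also have "\<dots> \<le> E1_norm m \<E> w"
      using big.energy_le_E1_norm[OF wF] big.E1_norm_nonneg[OF wF] by (intro real_le_lsqrt) auto
    also have "\<dots> \<le> E1_norm m \<E> u + 1"
      using big.E1.nrm_le_approx[OF uF wF] w(2) unfolding E1_norm_def by linarith
    finally have "big.E.nrm ?z \<le> 2 * big.E.nrm v + (E1_norm m \<E> u + 1)" using z(2) by linarith
    then have "(big.E.nrm ?z)\<^sup>2 \<le> ?M" using big.E.nrm_nonneg[OF z(1)] by (rule power_mono)
    then have "\<E> ?z ?z \<le> ?M" unfolding big.E.nrm_sq[OF z(1)] .
    with 1 show "\<exists>w\<in>?C. l2_norm m (\<lambda>x. v x - w x) < \<epsilon> \<and> \<E> w w \<le> ?M"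
      using z' sub1 by (intro bexI[of _ ?z] conjI) auto
  qed
  then show ?thesis by simp
qed

lemma (in dirichlet_form) bounded_part_add:
  assumes "f \<in> bounded_part m \<F>" "g \<in> bounded_part m \<F>"
  shows "(\<lambda>x. f x + g x) \<in> bounded_part m \<F>"
proof -
  from assms obtain a b where "AE x in m. \<bar>f x\<bar> \<le> a" "AE x in m. \<bar>g x\<bar> \<le> b"
    by (auto simp: bounded_part_def)
  then have "AE x in m. \<bar>f x + g x\<bar> \<le> a + b" by eventually_elim auto
  then show ?thesis using assms E.add by (auto simp: bounded_part_def)
qed

lemma (in dirichlet_form) bounded_part_scale:
  assumes "f \<in> bounded_part m \<F>"
  shows "(\<lambda>x. c * f x) \<in> bounded_part m \<F>"
proof -
  from assms obtain a where "AE x in m. \<bar>f x\<bar> \<le> a" by (auto simp: bounded_part_def)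
  then have "AE x in m. \<bar>c * f x\<bar> \<le> \<bar>c\<bar> * a"
    by eventually_elim (simp add: abs_mult mult_left_mono)
  then show ?thesis using assms E.scale by (auto simp: bounded_part_def)
qed

text \<open>The truncations of \<open>u\<^sup>+\<close> have no more energy than \<open>u\<close>, so the Fatou lemma, applied in the closure
  of the bounded functions, puts \<open>u\<^sup>+\<close> into this closure.\<close>

lemma (in dirichlet_form) bounded_part_dense:
  "E1_closure m \<E> \<F> (bounded_part m \<F>) = \<F>"
proof
  let ?D = "bounded_part m \<F>" and ?C = "E1_closure m \<E> \<F> (bounded_part m \<F>)"
  show "?C \<subseteq> \<F>" by (auto simp: E1_closure_def)
  have D: "?D \<subseteq> \<F>" by (auto simp: bounded_part_def)
  interpret C: closed_form m \<E> ?C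
  proof (rule closure_closed_form[OF D _ bounded_part_add bounded_part_scale])
    show "(\<lambda>x. 0) \<in> ?D" using E.zero by (auto simp: bounded_part_def)
  qed
  have pos: "(\<lambda>x. max (u x) 0) \<in> ?C" if u: "u \<in> \<F>" for u
  proof -
    let ?p = "\<lambda>x. max (u x) 0"
    have uL: "u \<in> L2 m" using in_L2[OF u] .
    have "?p \<in> ?C \<and> \<E> ?p ?p \<le> \<E> u u"
    proof (rule C.bounded_energy_L2_limit)
      show "?p \<in> L2 m" using in_L2[OF positive_part(1)[OF u]] .
      fix \<epsilon> :: real assume "\<epsilon> > 0"
      then have "\<forall>\<^sub>F n in sequentially. l2_norm m (\<lambda>x. ?p x - min (?p x) (real n)) < \<epsilon> \<and> n > 0"
        using order_tendstoD(2)[OF truncation_tendsto_L2[OF uL]] eventually_gt_at_top[of 0]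
        by (intro eventually_conj)
      then obtain n :: nat where n: "l2_norm m (\<lambda>x. ?p x - min (?p x) (real n)) < \<epsilon>" "real n > 0"
        by (auto simp: eventually_sequentially)
      note t = truncation[OF u n(2)]
      have "(\<lambda>x. min (?p x) (real n)) \<in> ?D"
        using t(1) by (auto simp: bounded_part_def intro!: exI[of _ "real n"])
      then show "\<exists>w\<in>?C. l2_norm m (\<lambda>x. ?p x - w x) < \<epsilon> \<and> \<E> w w \<le> \<E> u u"
        using subset_closure[OF D] n(1) t(2) by (intro bexI[of _ "\<lambda>x. min (?p x) (real n)"] conjI) auto
    qed
    then show ?thesis by simp
  qed
  show "\<F> \<subseteq> ?C"
  proof
    fix u assume u: "u \<in> \<F>"
    have "(\<lambda>x. max (u x) 0 - max (- 1 * u x) 0) \<in> ?C"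
      by (intro C.E.diff pos u E.scale)
    moreover have "(\<lambda>x. max (u x) 0 - max (- 1 * u x) 0) = u" by auto
    ultimately show "u \<in> ?C" by simp
  qed
qed

section \<open>Consequences of domination\<close>

locale dominated_pair = big: dirichlet_form m \<E> \<F> + small: dirichlet_form m \<E>' \<F>'
  for m :: "'a measure" and \<E> \<F> \<E>' \<F>' +
  assumes dominated: "dominated_by m \<E>' \<F>' \<E> \<F>"
begin

text \<open>The weak integrals that define the two resolvents are compared on the test function
  \<open>(G'\<^sub>\<alpha> f - G\<^sub>\<alpha> f)\<^sup>+\<close>, which must then vanish.\<close>

lemma resolvent_domination:
  assumes \<alpha>: "\<alpha> > 0" and f: "f \<in> L2 m" "AE x in m. 0 \<le> f x"
  obtains u' u where "small.is_resolvent \<alpha> f u'" "big.is_resolvent \<alpha> f u" "AE x in m. u' x \<le> u x"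
proof -
  obtain T' T where T': "associated_semigroup m \<E>' \<F>' T'" and T: "associated_semigroup m \<E> \<F> T"
    and le: "\<And>t. t \<ge> 0 \<Longrightarrow> AE x in m. T' t f x \<le> T t f x"
    using dominated f unfolding dominated_by_def by blast
  obtain u' where u': "small.is_resolvent \<alpha> f u'"
    and int': "\<And>g. g \<in> L2 m \<Longrightarrow>
      ((\<lambda>t. exp (- \<alpha> * t) * l2_inner m (T' t f) g) has_integral l2_inner m u' g) {0..}"
    using T' \<alpha> f(1) unfolding associated_semigroup_def small.is_resolvent_def by blast
  obtain u where u: "big.is_resolvent \<alpha> f u"
    and int: "\<And>g. g \<in> L2 m \<Longrightarrow>
      ((\<lambda>t. exp (- \<alpha> * t) * l2_inner m (T t f) g) has_integral l2_inner m u g) {0..}"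
    using T \<alpha> f(1) unfolding associated_semigroup_def big.is_resolvent_def by blast
  have TL: "T' t f \<in> L2 m" "T t f \<in> L2 m" if "t \<ge> 0" for t
    using T T' that f(1) l2_semigroup.maps_L2 unfolding associated_semigroup_def by blast+
  have uL: "u' \<in> L2 m" "u \<in> L2 m"
    using u u' small.in_L2 big.in_L2 by (auto simp: small.is_resolvent_def big.is_resolvent_def)
  let ?d = "\<lambda>x. u' x - u x" and ?h = "\<lambda>x. max (u' x - u x) 0"
  have d: "?d \<in> L2 m" using uL by (rule l2.diff)
  have h: "?h \<in> L2 m"
    using L2_measurable[OF d] by (intro L2_dominated[OF d, of _ 1]) auto
  have "l2_inner m u' ?h \<le> l2_inner m u ?h"
  proof (rule has_integral_le[OF int'[OF h] int[OF h]])
    fix t :: real assume "t \<in> {0..}"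
    then show "exp (- \<alpha> * t) * l2_inner m (T' t f) ?h \<le> exp (- \<alpha> * t) * l2_inner m (T t f) ?h"
      using TL le h by (intro mult_left_mono l2_inner_mono) auto
  qed
  then have "l2_inner m ?d ?h \<le> 0" using l2.diff_left[OF uL h] by simp
  moreover have "l2_inner m ?d ?h = l2_inner m ?h ?h"
    unfolding l2_inner_def by (rule Bochner_Integration.integral_cong) (auto simp: max_def)
  ultimately have "AE x in m. ?h x = 0" using AE_eq_0_of_l2_inner[OF h] by simp
  then have "AE x in m. u' x \<le> u x" by eventually_elim (auto simp: max_def split: if_splits)
  with u u' that show ?thesis by blast
qed

lemma approx_form_le:
  assumes \<alpha>: "\<alpha> > 0" and "small.is_resolvent \<alpha> f u'" "big.is_resolvent \<alpha> f u" "AE x in m. u' x \<le> u x"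
    and f: "f \<in> L2 m" and g: "g \<in> L2 m" "AE x in m. 0 \<le> g x"
  shows "big.approx_form \<alpha> u f g \<le> small.approx_form \<alpha> u' f g"
proof -
  have "u \<in> \<F>" "u' \<in> \<F>'" using assms(2,3) by (auto simp: small.is_resolvent_def big.is_resolvent_def)
  then have L: "(\<lambda>x. \<alpha> * u x) \<in> L2 m" "(\<lambda>x. \<alpha> * u' x) \<in> L2 m"
    using big.in_L2 small.in_L2 l2.scale by blast+
  have "l2_inner m (\<lambda>x. f x - \<alpha> * u x) g \<le> l2_inner m (\<lambda>x. f x - \<alpha> * u' x) g"
    using assms(4) \<alpha> by (intro l2_inner_mono l2.diff f g L) (auto simp: mult_left_mono)
  then show ?thesis using \<alpha> by (simp add: big.approx_form_def small.approx_form_def)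
qed

text \<open>For \<open>u \<ge> 0\<close> in \<open>\<F>'\<close> the larger numbers \<open>\<E>'\<^bsup>(\<alpha>)\<^esup>(u, u)\<close> are bounded, hence so are \<open>\<E>\<^bsup>(\<alpha>)\<^esup>(u, u)\<close>.\<close>

lemma subset: "\<F>' \<subseteq> \<F>"
proof -
  have nonneg: "u \<in> \<F>" if u: "u \<in> \<F>'" "AE x in m. 0 \<le> u x" for u
  proof -
    have uL: "u \<in> L2 m" using small.in_L2[OF u(1)] .
    obtain M where M: "\<And>\<alpha> w. \<lbrakk>\<alpha> > 0; small.is_resolvent \<alpha> u w\<rbrakk> \<Longrightarrow> small.approx_form \<alpha> w u u \<le> M"
      using small.approx_form_bounded[OF u(1)] by blast
    show ?thesis
    proof (rule big.in_domain_if_approx_bounded[OF uL])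
      fix \<alpha> :: real assume \<alpha>: "\<alpha> > 0"
      obtain w' w where w: "small.is_resolvent \<alpha> u w'" "big.is_resolvent \<alpha> u w" "AE x in m. w' x \<le> w x"
        using resolvent_domination[OF \<alpha> uL u(2)] .
      have "big.approx_form \<alpha> w u u \<le> M"
        using approx_form_le[OF \<alpha> w uL uL u(2)] M[OF \<alpha> w(1)] by linarith
      with w(2) show "\<exists>w. big.is_resolvent \<alpha> u w \<and> big.approx_form \<alpha> w u u \<le> M" by blast
    qed
  qed
  show ?thesis
  proof
    fix u assume u: "u \<in> \<F>'"
    have "(\<lambda>x. max (u x) 0 - max (- 1 * u x) 0) \<in> \<F>"
      using small.positive_part(1)[OF u] small.positive_part(1)[OF small.E.scale[OF u, of "-1"]]
      by (intro big.E.diff nonneg) auto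
    moreover have "(\<lambda>x. max (u x) 0 - max (- 1 * u x) 0) = u" by auto
    ultimately show "u \<in> \<F>" by simp
  qed
qed

text \<open>The inequality between the approximating forms passes to the limit.\<close>

lemma form_le:
  assumes f: "f \<in> \<F>'" "AE x in m. 0 \<le> f x" and g: "g \<in> \<F>'" "AE x in m. 0 \<le> g x"
  shows "\<E> f g \<le> \<E>' f g"
proof -
  have L: "f \<in> L2 m" "g \<in> L2 m" using f g small.in_L2 by auto
  have "\<exists>w' w. small.is_resolvent (real (Suc n)) f w' \<and> big.is_resolvent (real (Suc n)) f w
      \<and> (AE x in m. w' x \<le> w x)" for n
  proof -
    have "real (Suc n) > 0" by simp
    from resolvent_domination[OF this L(1) f(2)] show ?thesis by blast
  qed
  then obtain w' w where w': "\<And>n. small.is_resolvent (real (Suc n)) f (w' n)"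
    and w: "\<And>n. big.is_resolvent (real (Suc n)) f (w n)" and le: "\<And>n. AE x in m. w' n x \<le> w n x"
    by metis
  have "(\<lambda>n. big.approx_form (real (Suc n)) (w n) f g) \<longlonglongrightarrow> \<E> f g"
    using f(1) g(1) subset w by (intro big.approx_form_tendsto) auto
  moreover have "(\<lambda>n. small.approx_form (real (Suc n)) (w' n) f g) \<longlonglongrightarrow> \<E>' f g"
    using f(1) g(1) w' by (intro small.approx_form_tendsto)
  moreover have "big.approx_form (real (Suc n)) (w n) f g \<le> small.approx_form (real (Suc n)) (w' n) f g" for n
    using approx_form_le[OF _ w' w le L g(2)] by simp
  ultimately show ?thesis by (intro LIMSEQ_le) auto
qed

text \<open>With \<open>D = \<alpha>\<^sup>2 (G\<^sub>\<alpha> - G'\<^sub>\<alpha>)\<close>, which preserves positivity, \<open>0 \<le> v \<le> u\<close> gives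
  \<open>(D v, v) \<le> (D v, u) \<le> (D u, u)\<close>. The two ends are \<open>\<E>'\<^bsup>(\<alpha>)\<^esup>(v, v) - \<E>\<^bsup>(\<alpha>)\<^esup>(v, v)\<close> and \<open>\<E>'\<^bsup>(\<alpha>)\<^esup>(u, u) - \<E>\<^bsup>(\<alpha>)\<^esup>(u, u)\<close>.
  The resolvents of \<open>u\<close> are assembled from those of \<open>v\<close> and \<open>u - v\<close>, so that \<open>D u - D v\<close> is the
  nonnegative function \<open>D (u - v)\<close>.\<close>

lemma order_ideal:
  assumes u: "u \<in> \<F>'" and v: "v \<in> \<F>" "AE x in m. 0 \<le> v x" and vu: "AE x in m. v x \<le> u x"
  shows "v \<in> \<F>'"
proof -
  let ?h = "\<lambda>x. u x - v x"
  have uF: "u \<in> \<F>" using u subset by blast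
  have L: "u \<in> L2 m" "v \<in> L2 m" "?h \<in> L2 m"
    using big.in_L2[OF uF] big.in_L2[OF v(1)] big.in_L2[OF big.E.diff[OF uF v(1)]] .
  have h: "AE x in m. 0 \<le> ?h x" and u0: "AE x in m. 0 \<le> u x"
    using vu v(2) by (auto elim: eventually_elim2)
  obtain M where M: "\<And>\<alpha> w. \<lbrakk>\<alpha> > 0; big.is_resolvent \<alpha> v w\<rbrakk> \<Longrightarrow> big.approx_form \<alpha> w v v \<le> M"
    using big.approx_form_bounded[OF v(1)] by blast
  obtain M' where M': "\<And>\<alpha> w. \<lbrakk>\<alpha> > 0; small.is_resolvent \<alpha> u w\<rbrakk> \<Longrightarrow> small.approx_form \<alpha> w u u \<le> M'"
    using small.approx_form_bounded[OF u] by blast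
  show ?thesis
  proof (rule small.in_domain_if_approx_bounded[OF L(2)])
    fix \<alpha> :: real assume \<alpha>: "\<alpha> > 0"
    obtain a' a where a: "small.is_resolvent \<alpha> v a'" "big.is_resolvent \<alpha> v a" "AE x in m. a' x \<le> a x"
      using resolvent_domination[OF \<alpha> L(2) v(2)] .
    obtain b' b where b: "small.is_resolvent \<alpha> ?h b'" "big.is_resolvent \<alpha> ?h b" "AE x in m. b' x \<le> b x"
      using resolvent_domination[OF \<alpha> L(3) h] .
    have ab': "small.is_resolvent \<alpha> u (\<lambda>x. a' x + b' x)"
      using small.is_resolvent_add[OF a(1) b(1) L(2,3)] by simp
    have ab: "big.is_resolvent \<alpha> u (\<lambda>x. a x + b x)"
      using big.is_resolvent_add[OF a(2) b(2) L(2,3)] by simp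
    have in_L2: "a' \<in> L2 m" "a \<in> L2 m" "b' \<in> L2 m" "b \<in> L2 m"
      using a(1,2) b(1,2) small.in_L2 big.in_L2
      by (auto simp: small.is_resolvent_def big.is_resolvent_def)
    let ?da = "\<lambda>x. a x - a' x" and ?db = "\<lambda>x. b x - b' x"
    have dL: "?da \<in> L2 m" "?db \<in> L2 m" using in_L2 l2.diff by blast+
    have da: "AE x in m. 0 \<le> ?da x" and db: "AE x in m. 0 \<le> ?db x" using a(3) b(3) by auto
    have "l2_inner m ?da v \<le> l2_inner m ?da u"
      using l2_inner_mono[OF L(2,1) dL(1) vu da] by (simp add: l2_inner_commute[of m ?da])
    also have "\<dots> \<le> l2_inner m ?da u + l2_inner m ?db u"
      using l2_inner_mono[OF l2.zero dL(2) L(1) db u0] by (simp add: l2_inner_def)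
    finally have le: "\<alpha> * \<alpha> * l2_inner m ?da v \<le> \<alpha> * \<alpha> * (l2_inner m ?da u + l2_inner m ?db u)"
      by (intro mult_left_mono) auto
    have eq: "small.approx_form \<alpha> a' v v = big.approx_form \<alpha> a v v + \<alpha> * \<alpha> * l2_inner m ?da v"
      using in_L2 L
      by (simp add: small.approx_form_def big.approx_form_def l2.bilinear algebra_simps)
    have eq': "\<alpha> * \<alpha> * (l2_inner m ?da u + l2_inner m ?db u)
        = small.approx_form \<alpha> (\<lambda>x. a' x + b' x) u u - big.approx_form \<alpha> (\<lambda>x. a x + b x) u u"
    proof -
      have *: "small.approx_form \<alpha> (\<lambda>x. c x + d x) u u
          = \<alpha> * (l2_inner m u u - \<alpha> * (l2_inner m c u + l2_inner m d u))"
        if "c \<in> L2 m" "d \<in> L2 m" for c d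
        using that L l2.scale[OF l2.add[OF that], of \<alpha>]
        by (simp add: small.approx_form_def l2.diff_left l2.scale_left l2.add_left l2.add)
      show ?thesis
        unfolding *[OF in_L2(1,3)] *[OF in_L2(2,4)] l2.diff_left[OF in_L2(2,1) L(1)]
          l2.diff_left[OF in_L2(4,3) L(1)]
        by (simp add: algebra_simps)
    qed
    have "0 \<le> big.approx_form \<alpha> (\<lambda>x. a x + b x) u u"
    proof -
      let ?w = "\<lambda>x. \<alpha> * (a x + b x)"
      have w: "?w \<in> \<F>" using ab by (auto simp: big.is_resolvent_def intro: big.E.scale)
      have "0 \<le> \<alpha> * l2_inner m (\<lambda>x. u x - ?w x) (\<lambda>x. u x - ?w x)"
        using l2.nonneg[OF l2.diff[OF L(1) big.in_L2[OF w]]] \<alpha> by simp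
      then show ?thesis using big.energy_resolvent[OF ab L(1)] big.E.nonneg[OF w] by linarith
    qed
    then have "small.approx_form \<alpha> a' v v \<le> M + M'"
      using eq eq' le M[OF \<alpha> a(2)] M'[OF \<alpha> ab'] by linarith
    with a(1) show "\<exists>w. small.is_resolvent \<alpha> v w \<and> small.approx_form \<alpha> w v v \<le> M + M'" by blast
  qed
qed

end

section \<open>The intermediate form\<close>

text \<open>Bounded approximations of an element of \<open>D\<close> form a Cauchy sequence for \<open>\<Q>\<^sub>1\<close>, hence for \<open>\<E>\<^sub>1\<close>, and both
  forms are continuous along such sequences.\<close>

lemma restriction_if_agree_on_bounded:
  assumes big: "dirichlet_form m \<E> \<F>" and small: "dirichlet_form m \<Q> D"
    and sub: "bounded_part m D \<subseteq> \<F>"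
    and eq: "\<And>f g. \<lbrakk>f \<in> bounded_part m D; g \<in> bounded_part m D\<rbrakk> \<Longrightarrow> \<E> f g = \<Q> f g"
  shows "D \<subseteq> \<F>" and "\<And>f g. \<lbrakk>f \<in> D; g \<in> D\<rbrakk> \<Longrightarrow> \<Q> f g = \<E> f g"
proof -
  interpret big: dirichlet_form m \<E> \<F> by (rule big)
  interpret small: dirichlet_form m \<Q> D by (rule small)
  let ?B = "bounded_part m D"
  have BD: "?B \<subseteq> D" by (auto simp: bounded_part_def)
  have B_diff: "(\<lambda>x. f x - g x) \<in> ?B" if "f \<in> ?B" "g \<in> ?B" for f g
    using small.bounded_part_add[OF that(1) small.bounded_part_scale[OF that(2), of "-1"]] by simp
  have norm_eq: "E1_norm m \<E> f = E1_norm m \<Q> f" if "f \<in> ?B" for f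
    using eq[OF that that] by (simp add: E1_norm_def form_shift_def)
  have approx: "f \<in> \<F> \<and> (\<exists>w. (\<forall>n::nat. w n \<in> ?B) \<and> (\<lambda>n. E1_norm m \<Q> (\<lambda>x. w n x - f x)) \<longlonglongrightarrow> 0
      \<and> (\<lambda>n. E1_norm m \<E> (\<lambda>x. w n x - f x)) \<longlonglongrightarrow> 0)" if f: "f \<in> D" for f
  proof -
    have "f \<in> E1_closure m \<Q> D ?B" using f small.bounded_part_dense by simp
    from small.closure_sequence[OF BD this]
    obtain w where w: "\<And>n::nat. w n \<in> ?B"
      and lim: "(\<lambda>n. E1_norm m \<Q> (\<lambda>x. w n x - f x)) \<longlonglongrightarrow> 0" by blast
    have wD: "w n \<in> D" for n using w BD by blast
    have wF: "w n \<in> \<F>" for n using w sub by blast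
    have "\<forall>\<epsilon>>0. \<exists>N. \<forall>i\<ge>N. \<forall>j\<ge>N. E1_norm m \<Q> (\<lambda>x. w i x - w j x) < \<epsilon>"
      using small.E1.Cauchy_of_tendsto[OF wD f lim[unfolded E1_norm_def]] by (simp only: E1_norm_def)
    then have "\<forall>\<epsilon>>0. \<exists>N. \<forall>i\<ge>N. \<forall>j\<ge>N. E1_norm m \<E> (\<lambda>x. w i x - w j x) < \<epsilon>"
      unfolding norm_eq[OF B_diff[OF w w]] .
    from big.closed_L2_limit[OF wF this small.in_L2[OF f] small.l2_tendsto_of_E1[OF wD f lim]]
    show ?thesis using w lim by blast
  qed
  then show "D \<subseteq> \<F>" by blast
  fix f g assume fg: "f \<in> D" "g \<in> D"
  obtain a where a: "\<And>n::nat. a n \<in> ?B" "(\<lambda>n. E1_norm m \<Q> (\<lambda>x. a n x - f x)) \<longlonglongrightarrow> 0"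
    "(\<lambda>n. E1_norm m \<E> (\<lambda>x. a n x - f x)) \<longlonglongrightarrow> 0" using approx[OF fg(1)] by blast
  obtain b where b: "\<And>n::nat. b n \<in> ?B" "(\<lambda>n. E1_norm m \<Q> (\<lambda>x. b n x - g x)) \<longlonglongrightarrow> 0"
    "(\<lambda>n. E1_norm m \<E> (\<lambda>x. b n x - g x)) \<longlonglongrightarrow> 0" using approx[OF fg(2)] by blast
  have in_D: "a n \<in> D" "b n \<in> D" and in_F: "a n \<in> \<F>" "b n \<in> \<F>" for n
    using a(1) b(1) BD sub by blast+
  have "(\<lambda>n. \<Q> (a n) (b n)) \<longlonglongrightarrow> \<Q> f g"
    by (rule small.form_tendsto[OF in_D fg a(2) b(2)])
  moreover have "(\<lambda>n. \<Q> (a n) (b n)) \<longlonglongrightarrow> \<E> f g"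
    using big.form_tendsto[OF in_F _ _ a(3) b(3)] approx fg eq[OF a(1) b(1)] by simp
  ultimately show "\<Q> f g = \<E> f g" by (rule LIMSEQ_unique)
qed

text \<open>The two norms agree on \<open>D\<close>, and \<open>D\<close> is complete, so a limit of elements of \<open>S\<close> taken in \<open>\<F>\<close> cannot
  leave \<open>D\<close>.\<close>

lemma closure_in_restriction:
  assumes big: "dirichlet_form m \<E> \<F>" and small: "dirichlet_form m \<Q> D"
    and sub: "D \<subseteq> \<F>" and eq: "\<And>f g. \<lbrakk>f \<in> D; g \<in> D\<rbrakk> \<Longrightarrow> \<Q> f g = \<E> f g"
    and S: "S \<subseteq> D"
  shows "E1_closure m \<E> \<F> S = E1_closure m \<Q> D S"
proof
  interpret big: dirichlet_form m \<E> \<F> by (rule big)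
  interpret small: dirichlet_form m \<Q> D by (rule small)
  have norm_eq: "E1_norm m \<E> f = E1_norm m \<Q> f" if "f \<in> D" for f
    using eq[OF that that] by (simp add: E1_norm_def form_shift_def)
  have diff: "(\<lambda>x. f x - g x) \<in> D" if "f \<in> D" "g \<in> S" for f g
    using small.E.diff[OF that(1)] that(2) S by blast
  show "E1_closure m \<Q> D S \<subseteq> E1_closure m \<E> \<F> S"
  proof
    fix f assume f: "f \<in> E1_closure m \<Q> D S"
    then have "f \<in> D" by (simp add: E1_closure_def)
    then show "f \<in> E1_closure m \<E> \<F> S"
      using f sub norm_eq[OF diff[OF \<open>f \<in> D\<close>]] by (auto simp: E1_closure_def)
  qed
  show "E1_closure m \<E> \<F> S \<subseteq> E1_closure m \<Q> D S"
  proof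
    fix f assume f: "f \<in> E1_closure m \<E> \<F> S"
    then have fF: "f \<in> \<F>" by (simp add: E1_closure_def)
    obtain w where w: "\<And>n::nat. w n \<in> S" and lim: "(\<lambda>n. E1_norm m \<E> (\<lambda>x. w n x - f x)) \<longlonglongrightarrow> 0"
      using big.closure_sequence[OF order_trans[OF S sub] f] by blast
    have wD: "w n \<in> D" for n using w S by blast
    have wF: "w n \<in> \<F>" for n using wD sub by blast
    have "\<forall>\<epsilon>>0. \<exists>N. \<forall>i\<ge>N. \<forall>j\<ge>N. E1_norm m \<E> (\<lambda>x. w i x - w j x) < \<epsilon>"
      using big.E1.Cauchy_of_tendsto[OF wF fF lim[unfolded E1_norm_def]] by (simp only: E1_norm_def)
    then have "\<forall>\<epsilon>>0. \<exists>N. \<forall>i\<ge>N. \<forall>j\<ge>N. E1_norm m \<Q> (\<lambda>x. w i x - w j x) < \<epsilon>"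
      unfolding norm_eq[OF small.E.diff[OF wD wD]] .
    from small.closed_L2_limit(1)[OF wD this big.in_L2[OF fF] big.l2_tendsto_of_E1[OF wF fF lim]]
    have fD: "f \<in> D" .
    then show "f \<in> E1_closure m \<Q> D S"
      using f norm_eq[OF diff[OF fD]] by (auto simp: E1_closure_def)
  qed
qed

theorem theorem2p4:
  fixes m :: "'a measure"
    and \<E> \<E>' :: "('a \<Rightarrow> real) \<Rightarrow> ('a \<Rightarrow> real) \<Rightarrow> real"
    and \<F> \<F>' :: "('a \<Rightarrow> real) set"
  assumes "sigma_finite_measure m"
    and "dirichlet_form m \<E> \<F>"
    and "dirichlet_form m \<E>' \<F>'"
    and "dominated_by m \<E>' \<F>' \<E> \<F>"
  shows "dirichlet_form m \<E> (E1_closure m \<E> \<F> \<F>')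
    \<and> strongly_subordinate m \<E>' \<F>' \<E> (E1_closure m \<E> \<F> \<F>')
    \<and> silverstein_extension m \<E> \<F> \<E> (E1_closure m \<E> \<F> \<F>')
    \<and> (\<forall>\<E>1 \<F>1. dirichlet_form m \<E>1 \<F>1
          \<longrightarrow> strongly_subordinate m \<E>' \<F>' \<E>1 \<F>1
          \<longrightarrow> silverstein_extension m \<E> \<F> \<E>1 \<F>1
          \<longrightarrow> \<F>1 = E1_closure m \<E> \<F> \<F>'
            \<and> (\<forall>f\<in>\<F>1. \<forall>g\<in>\<F>1. \<E>1 f g = \<E> f g))"
proof -
  interpret dominated_pair m \<E> \<F> \<E>' \<F>'
    by (intro dominated_pair.intro dominated_pair_axioms.intro assms)
  let ?C = "E1_closure m \<E> \<F> \<F>'"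
  have C: "dirichlet_form m \<E> ?C"
    by (rule dirichlet_form_closure[OF assms(2,3) subset])
  have sub: "\<F>' \<subseteq> ?C" by (rule big.subset_closure[OF subset])
  have CF: "?C \<subseteq> \<F>" by (auto simp: E1_closure_def)
  have "E1_closure m \<E> ?C \<F>' = ?C"
    by (rule closure_in_restriction[OF assms(2) C CF refl sub, symmetric])
  then have strong: "strongly_subordinate m \<E>' \<F>' \<E> ?C"
    using sub form_le by (simp add: strongly_subordinate_def subordinate_def)
  have silverstein: "silverstein_extension m \<E> \<F> \<E> ?C"
    unfolding silverstein_extension_def
    using algebraic_ideal_if_order_ideal[OF assms(2) C CF
        order_ideal_closure[OF assms(2,3) subset order_ideal]] by simp
  have unique: "\<F>1 = ?C \<and> (\<forall>f\<in>\<F>1. \<forall>g\<in>\<F>1. \<E>1 f g = \<E> f g)"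
    if F1: "dirichlet_form m \<E>1 \<F>1" and strong1: "strongly_subordinate m \<E>' \<F>' \<E>1 \<F>1"
      and silverstein1: "silverstein_extension m \<E> \<F> \<E>1 \<F>1" for \<E>1 \<F>1
  proof -
    have bsub: "bounded_part m \<F>1 \<subseteq> \<F>"
      using silverstein1 by (auto simp: silverstein_extension_def algebraic_ideal_def bounded_part_def)
    have beq: "\<E> f g = \<E>1 f g" if "f \<in> bounded_part m \<F>1" "g \<in> bounded_part m \<F>1" for f g
      using silverstein1 that by (simp add: silverstein_extension_def)
    note sub1 = restriction_if_agree_on_bounded(1)[OF assms(2) F1 bsub beq]
      and eq = restriction_if_agree_on_bounded(2)[OF assms(2) F1 bsub beq]
    have "\<F>' \<subseteq> \<F>1" "E1_closure m \<E>1 \<F>1 \<F>' = \<F>1"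
      using strong1 by (auto simp: strongly_subordinate_def subordinate_def)
    then have "\<F>1 = ?C" using closure_in_restriction[OF assms(2) F1 sub1 eq] by simp
    with eq show ?thesis by blast
  qed
  show ?thesis using C strong silverstein unique by blast
qed

end
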